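(* Let $d\ge3$ be odd and consider the fermionic triangular honeycomb color code of distance $d$ on $n=(3d^2+1)/4$ sites per codeblock. For a fermionic codeblock $x$ let $\gamma^{\mathrm L}_x=\prod_{i=1}^n\gamma^x_i$ and $\tilde\gamma^{\mathrm L}_x=\prod_{i=1}^n\tilde\gamma^x_i$, and for a plaquette $p$ let $G^x_p=\prod_{i\in p}\gamma^x_i$ and $\tilde G^x_p=\prod_{i\in p}\tilde\gamma^x_i$ be its stabilizer products. For a qubit color codeblock $q$ on the same lattice let $X^{\mathrm L}_q=\prod_i X^q_i$, $Z^{\mathrm L}_q=\prod_iZ_i^q$, with stabilizers $\prod_{i\in p}X^q_i$ and $\prod_{i\in p}Z^q_i$. Then the following transversal gates are logical gates: conjugation $A\mapsto U^\dagger AU$ maps each stabilizer product to a product of stabilizer products with no additional sign, and acts on the logical operators exactly as the corresponding physical gate acts on physical operators. Explicitly, for distinct fermionic codeblocks $a,b$ and a qubit codeblock $q$ (logical operators not listed being invariant): 1. $U=\prod_{i=1}^n\exp(-\frac{\pi}{4}\tilde\gamma^a_i\gamma^b_i)$ is a logical $\mathrm{BRAID}_{ab}$: $\tilde\gamma^{\mathrm L}_a\mapsto-\gamma^{\mathrm L}_b$ and $\gamma^{\mathrm L}_b\mapsto\tilde\gamma^{\mathrm L}_a$. 2. $U=\prod_{i=1}^n\exp(i\frac{\pi}{2}n^a_i)$ is a logical $\mathrm S^{\mathrm f}_a$: $\gamma^{\mathrm L}_a\mapsto\tilde\gamma^{\mathrm L}_a$ and $\tilde\gamma^{\mathrm L}_a\mapsto-\gamma^{\mathrm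 L}_a$. 3. $U=\prod_{i=1}^n\exp(-i\pi n^a_in^b_i)$ is a logical $\mathrm{CZ}^{\mathrm f}_{ab}$: with $Z^{\mathrm L}_x=-i\tilde\gamma^{\mathrm L}_x\gamma^{\mathrm L}_x$, $\gamma^{\mathrm L}_a\mapsto\gamma^{\mathrm L}_aZ^{\mathrm L}_b$, $\tilde\gamma^{\mathrm L}_a\mapsto\tilde\gamma^{\mathrm L}_aZ^{\mathrm L}_b$, $\gamma^{\mathrm L}_b\mapsto\gamma^{\mathrm L}_bZ^{\mathrm L}_a$, $\tilde\gamma^{\mathrm L}_b\mapsto\tilde\gamma^{\mathrm L}_bZ^{\mathrm L}_a$. 4. $U=\prod_{i=1}^n\exp(-i\pi n^{\mathrm q,q}_in^b_i)$ is a logical $\mathrm{CZ}^{\mathrm{qf}}_{qb}$: $\gamma^{\mathrm L}_b\mapsto Z^{\mathrm L}_q\gamma^{\mathrm L}_b$, $\tilde\gamma^{\mathrm L}_b\mapsto Z^{\mathrm L}_q\tilde\gamma^{\mathrm L}_b$, and $X^{\mathrm L}_q\mapsto(-i\tilde\gamma^{\mathrm L}_b\gamma^{\mathrm L}_b)X^{\mathrm L}_q$.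
   Context: Site $i$ of fermionic block $x$ carries operators $p_i^x,(p_i^x)^\dagger$ with canonical anticommutation relations (also between different blocks), Majorana operators $\gamma_i^x,\tilde\gamma_i^x$ defined by $(p_i^x)^\dagger=\frac12(\gamma_i^x+i\tilde\gamma_i^x)$, and number operator $n_i^x=(p_i^x)^\dagger p_i^x=\frac12(1+i\tilde\gamma^x_i\gamma^x_i)$. Qubit operators commute with all fermionic operators; $n_i^{\mathrm q,q}=|1\rangle\langle1|$ on qubit $i$ of block $q$. All products over sites are taken in increasing site order. The triangular honeycomb color code of odd distance $d$ lives on a triangular patch of the hexagonal lattice with $n=(3d^2+1)/4$ vertices (one site per vertex); each of its plaquettes contains either four or six vertices ($d=3$ gives the Steane code, with $n=7$ and three plaquettes of four vertices). The qubit code has stabilizers $\prod_{i\in p}X_i$ and $\prod_{i\in p}Z_i$ for each plaquette $p$; the fermionic code is obtained by replacing these by the products $\prod_{i\in p}\gamma_i$ and $\prod_{i\in p}\tilde\gamma_i$. Physical gates: $\mathrm{BRAID}_{ij}=\exp(-\frac{\pi}{4}\tilde\gamma_i\gamma_j)$, $\mathrm S^{\mathrm f}_i=e^{i\frac\pi2 n_i}$, $\mathrm{CZ}^{\mathrm f}_{ij}=e^{-i\pi n_in_j}$, $\mathrm{CZ}^{\mathrm{qf}}_{ij}=e^{-i\pi n_i^{\mathrm q}n_j}$. Under $A\mapsto U^\dagger AU$ they act on physical operators as follows, with $Z^{\mathrm f}_i=-i\tilde\gamma_i\gamma_i$: $\mathrm{BRAID}_{ij}$: $\tilde\gamma_i\mapsto-\gamma_j$,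 $\gamma_j\mapsto\tilde\gamma_i$; $\mathrm S_i^{\mathrm f}$: $\gamma_i\mapsto\tilde\gamma_i$, $\tilde\gamma_i\mapsto-\gamma_i$; $\mathrm{CZ}^{\mathrm f}_{ij}$: $\gamma_i\mapsto\gamma_iZ_j^{\mathrm f}$, $\tilde\gamma_i\mapsto\tilde\gamma_iZ_j^{\mathrm f}$ and likewise with $i\leftrightarrow j$; $\mathrm{CZ}^{\mathrm{qf}}_{ij}$: $\gamma_j\mapsto Z_i\gamma_j$, $\tilde\gamma_j\mapsto Z_i\tilde\gamma_j$, $X_i\mapsto Z_j^{\mathrm f}X_i$. *)

theory Defs
  imports "HOL-Analysis.Analysis"
begin

section \<open>Operators on a finite-dimensional Hilbert space\<close>

text \<open>Operators on the Hilbert space with orthonormal basis indexed by the finite type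
  \<open>'h\<close>.  Finitely many fermionic modes and qubits always act on such a space; \<open>'h\<close> stays
  arbitrary, so no particular representation is singled out.\<close>

type_synonym 'h operator = "complex^'h^'h"

definition dagger :: "'h::finite operator \<Rightarrow> 'h operator" where
  "dagger A = map_matrix cnj (transpose A)"

definition cscale :: "complex \<Rightarrow> 'h::finite operator \<Rightarrow> 'h operator"  (infixr "*\<^sub>C" 75) where
  "c *\<^sub>C A = map_matrix ((*) c) A"

primrec mpower :: "'h::finite operator \<Rightarrow> nat \<Rightarrow> 'h operator" where
  "mpower A 0 = mat 1"
| "mpower A (Suc k) = A ** mpower A k"

definition mexp :: "'h::finite operator \<Rightarrow> 'h operator" where
  "mexp A = (\<Sum>k. (1 / fact k) *\<^sub>R mpower A k)"

text \<open>The power series converges for every matrix, so the \<open>suminf\<close> above is never a junk value.\<close>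

lemma mexp_sums: "(\<lambda>k. (1 / fact k) *\<^sub>R mpower A k) sums mexp A"
  for A :: "'h::finite operator"
proof -
  define M where "M = (\<Sum>i\<in>UNIV. \<Sum>j\<in>UNIV. norm (A $ i $ j))"
  have M0: "M \<ge> 0" unfolding M_def by (intro sum_nonneg) auto
  have row: "(\<Sum>l\<in>UNIV. norm (A $ i $ l)) \<le> M" for i
    unfolding M_def by (rule member_le_sum[where f = "\<lambda>i. \<Sum>j\<in>UNIV. norm (A $ i $ j)"])
      (auto intro: sum_nonneg)
  have bnd: "norm (mpower A k $ i $ j) \<le> M ^ k" for k i j
  proof (induction k arbitrary: i j)
    case 0
    then show ?case by (simp add: mat_def)
  next
    case (Suc k)
    have "norm (mpower A (Suc k) $ i $ j) \<le> (\<Sum>l\<in>UNIV. norm (A $ i $ l * mpower A k $ l $ j))"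
      by (simp add: matrix_matrix_mult_def sum_norm_le)
    also have "\<dots> \<le> (\<Sum>l\<in>UNIV. norm (A $ i $ l) * M ^ k)"
      by (intro sum_mono) (simp add: norm_mult mult_left_mono Suc.IH)
    also have "\<dots> \<le> M * M ^ k"
      by (simp flip: sum_distrib_right add: mult_right_mono row M0)
    finally show ?case by simp
  qed
  have ent: "summable (\<lambda>k. ((1 / fact k) *\<^sub>R mpower A k) $ i $ j)" for i j
  proof (rule summable_comparison_test)
    show "\<exists>N. \<forall>k\<ge>N. norm (((1 / fact k) *\<^sub>R mpower A k) $ i $ j) \<le> inverse (fact k) * M ^ k"
      using bnd by (auto simp: divide_inverse intro!: mult_left_mono)
    show "summable (\<lambda>k. inverse (fact k) * M ^ k)" by (rule summable_exp)
  qed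
  have "(\<lambda>k. (1 / fact k) *\<^sub>R mpower A k) sums
      (\<chi> i j. \<Sum>k. ((1 / fact k) *\<^sub>R mpower A k) $ i $ j)"
    unfolding sums_def
  proof (intro vec_tendstoI)
    fix i j
    show "(\<lambda>N. (\<Sum>k<N. (1 / fact k) *\<^sub>R mpower A k) $ i $ j)
        \<longlonglongrightarrow> (\<chi> i j. \<Sum>k. ((1 / fact k) *\<^sub>R mpower A k) $ i $ j) $ i $ j"
      using summable_LIMSEQ[OF ent[of i j]] by simp
  qed
  then show ?thesis
    unfolding mexp_def by (rule summable_sums[OF sums_summable])
qed

definition heisenberg :: "'h::finite operator \<Rightarrow> 'h operator \<Rightarrow> 'h operator" where
  "heisenberg U A = dagger U ** A ** U"

text \<open>Product over a finite set of sites, the smallest site being the leftmost factor.\<close>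

definition site_prod :: "nat set \<Rightarrow> (nat \<Rightarrow> 'h::finite operator) \<Rightarrow> 'h operator" where
  "site_prod S f = foldr (\<lambda>i A. f i ** A) (sorted_list_of_set S) (mat 1)"


section \<open>The triangular honeycomb patch\<close>

text \<open>Points are coordinates \<open>x e\<^sub>1 + y e\<^sub>2\<close> of the triangular lattice whose basis vectors enclose an
  angle of 60 degrees.  Removing the points with \<open>x - y \<equiv> 1\<close> modulo \<open>3\<close> leaves the
  vertices of a hexagonal lattice; the removed points are the centres of its hexagons.
  The distance-\<open>d\<close> patch is the equilateral triangle of side length \<open>3 (d - 1) / 2\<close>,
  each side of which carries \<open>d\<close> vertices.  A plaquette is a hexagon centred in the patch,
  cut off at the boundary of the patch.\<close>

definition patch :: "nat \<Rightarrow> (int \<times> int) set" where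
  "patch d = {(x, y). 0 \<le> x \<and> 0 \<le> y \<and> 2 * (x + y) \<le> 3 * (int d - 1)}"

definition hex_centres :: "nat \<Rightarrow> (int \<times> int) set" where
  "hex_centres d = {(x, y) \<in> patch d. (x - y) mod 3 = 1}"

definition vertices :: "nat \<Rightarrow> (int \<times> int) set" where
  "vertices d = patch d - hex_centres d"

definition neighbours :: "int \<times> int \<Rightarrow> (int \<times> int) set" where
  "neighbours c = (\<lambda>(u, v). (fst c + u, snd c + v)) `
     {(1, 0), (-1, 0), (0, 1), (0, -1), (1, -1), (-1, 1)}"

definition plaquettes :: "nat \<Rightarrow> (int \<times> int) set set" where
  "plaquettes d = (\<lambda>c. neighbours c \<inter> vertices d) ` hex_centres d"

text \<open>Plaquettes as sets of sites, for a numbering \<open>vert\<close> of the vertices by \<open>1, \<dots>, n\<close>.\<close>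

definition site_plaquettes :: "nat \<Rightarrow> nat \<Rightarrow> (nat \<Rightarrow> int \<times> int) \<Rightarrow> nat set set" where
  "site_plaquettes d n vert = (\<lambda>P. {i \<in> {1..n}. vert i \<in> P}) ` plaquettes d"


text \<open>The counts known for this family: the vertices can indeed be numbered by
  \<open>1, \<dots>, (3 d\<^sup>2 + 1) / 4\<close>, and plaquettes have four or six vertices.\<close>

lemma vertices_Suc_row:
  fixes k :: nat
  shows "vertices (2 * k + 3) = vertices (2 * k + 1)
    \<union> (\<lambda>x. (x, 3 * int k + 1 - x)) ` ({0..3 * int k + 1} - (\<lambda>j. 3 * j + 1) ` {0..int k})
    \<union> (\<lambda>x. (x, 3 * int k + 2 - x)) ` ({0..3 * int k + 2} - (\<lambda>j. 3 * j) ` {0..int k})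
    \<union> (\<lambda>x. (x, 3 * int k + 3 - x)) ` ({0..3 * int k + 3} - (\<lambda>j. 3 * j + 2) ` {0..int k})"
    (is "?L = ?V \<union> ?A \<union> ?B \<union> ?C")
proof (rule set_eqI)
  fix c :: "int \<times> int"
  obtain x y where c: "c = (x, y)" by (cases c)
  have v: "(x, y) \<in> vertices (2 * m + 1) \<longleftrightarrow>
      0 \<le> x \<and> 0 \<le> y \<and> x + y \<le> 3 * int m \<and> (x - y) mod 3 \<noteq> 1" for m
    by (auto simp: vertices_def hex_centres_def patch_def)
  have A: "(x, y) \<in> ?A \<longleftrightarrow> 0 \<le> x \<and> 0 \<le> y \<and> x + y = 3 * int k + 1 \<and> (x - y) mod 3 \<noteq> 1"
  proof -
    have "(\<exists>j\<in>{0..int k}. x = 3 * j + 1) \<longleftrightarrow> (x - y) mod 3 = 1"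
      if "0 \<le> x" "0 \<le> y" "x + y = 3 * int k + 1"
      using that unfolding Bex_def atLeastAtMost_iff by presburger
    then show ?thesis by (auto simp: image_iff)
  qed
  have B: "(x, y) \<in> ?B \<longleftrightarrow> 0 \<le> x \<and> 0 \<le> y \<and> x + y = 3 * int k + 2 \<and> (x - y) mod 3 \<noteq> 1"
  proof -
    have "(\<exists>j\<in>{0..int k}. x = 3 * j) \<longleftrightarrow> (x - y) mod 3 = 1"
      if "0 \<le> x" "0 \<le> y" "x + y = 3 * int k + 2"
      using that unfolding Bex_def atLeastAtMost_iff by presburger
    then show ?thesis by (auto simp: image_iff)
  qed
  have C: "(x, y) \<in> ?C \<longleftrightarrow> 0 \<le> x \<and> 0 \<le> y \<and> x + y = 3 * int k + 3 \<and> (x - y) mod 3 \<noteq> 1"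
  proof -
    have "(\<exists>j\<in>{0..int k}. x = 3 * j + 2) \<longleftrightarrow> (x - y) mod 3 = 1"
      if "0 \<le> x" "0 \<le> y" "x + y = 3 * int k + 3"
      using that unfolding Bex_def atLeastAtMost_iff by presburger
    then show ?thesis by (auto simp: image_iff)
  qed
  have "2 * k + 3 = 2 * Suc k + 1" by simp
  then show "c \<in> ?L \<longleftrightarrow> c \<in> ?V \<union> ?A \<union> ?B \<union> ?C"
    unfolding c Un_iff A B C v[of k] by (simp only: v) auto
qed

lemma card_vertices_aux: "finite (vertices (2 * k + 1)) \<and> card (vertices (2 * k + 1)) = 3 * k * (k + 1) + 1"
proof (induction k)
  case 0
  have "vertices 1 = {(0, 0)}" by (auto simp: vertices_def hex_centres_def patch_def)
  then show ?case by simp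
next
  case (Suc k)
  let ?A = "{0..3 * int k + 1} - (\<lambda>j. 3 * j + 1) ` {0..int k}"
  let ?B = "{0..3 * int k + 2} - (\<lambda>j. 3 * j) ` {0..int k}"
  let ?C = "{0..3 * int k + 3} - (\<lambda>j. 3 * j + 2) ` {0..int k}"
  let ?f = "\<lambda>s x. (x, s - x) :: int \<times> int"
  let ?V = "vertices (2 * k + 1)"
  have "card ?A = 2 * k + 1"
    by (subst card_Diff_subset) (auto simp: card_image inj_on_def)
  moreover have "card ?B = 2 * k + 2"
    by (subst card_Diff_subset) (auto simp: card_image inj_on_def)
  moreover have "card ?C = 2 * k + 3"
    by (subst card_Diff_subset) (auto simp: card_image inj_on_def)
  moreover have "card (?f s ` S) = card S" for s :: int and S
    by (rule card_image) (auto simp: inj_on_def)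
  moreover have "x + y \<le> 3 * int k" if "(x, y) \<in> ?V" for x y
    using that by (auto simp: vertices_def patch_def)
  then have "?V \<inter> ?f (3 * int k + 1) ` ?A = {}"
    "(?V \<union> ?f (3 * int k + 1) ` ?A) \<inter> ?f (3 * int k + 2) ` ?B = {}"
    "(?V \<union> ?f (3 * int k + 1) ` ?A \<union> ?f (3 * int k + 2) ` ?B) \<inter> ?f (3 * int k + 3) ` ?C = {}"
    by fastforce+
  ultimately have "card (vertices (2 * k + 3)) = card ?V + (2 * k + 1) + (2 * k + 2) + (2 * k + 3)"
    using Suc unfolding vertices_Suc_row by (simp add: card_Un_disjoint del: Un_Diff_Int)
  moreover have "finite (vertices (2 * k + 3))" using Suc unfolding vertices_Suc_row by simp
  moreover have eq: "2 * Suc k + 1 = 2 * k + 3" by simp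
  ultimately show ?case using Suc unfolding eq by (simp add: algebra_simps)
qed

lemma card_vertices:
  assumes "odd d"
  shows "card (vertices d) = (3 * d\<^sup>2 + 1) div 4"
proof -
  obtain k where "d = 2 * k + 1" using assms by (elim oddE)
  moreover have "3 * (2 * k + 1)\<^sup>2 + 1 = 4 * (3 * k * (k + 1) + 1)" by (simp add: power2_eq_square algebra_simps)
  ultimately show ?thesis using card_vertices_aux[of k] by (metis nonzero_mult_div_cancel_left zero_neq_numeral)
qed

lemma numbering_exists:
  assumes "odd d"
  shows "\<exists>vert. bij_betw vert {1..(3 * d\<^sup>2 + 1) div 4} (vertices d)"
proof -
  have "finite (vertices d)" using assms card_vertices_aux by (metis oddE)
  then show ?thesis
    by (intro finite_same_card_bij) (simp_all add: card_vertices[OF assms])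
qed

lemma card_plaquette:
  assumes "odd d" "P \<in> plaquettes d"
  shows "card P \<in> {4, 6}"
proof -
  obtain k where k: "d = 2 * k + 1" using assms by (elim oddE)
  obtain x y where P: "P = neighbours (x, y) \<inter> vertices d"
    and c: "0 \<le> x" "0 \<le> y" "x + y \<le> 3 * int k" "(x - y) mod 3 = 1"
    using assms(2) by (auto simp: plaquettes_def hex_centres_def patch_def k)
  obtain t where t: "x = y + 3 * t + 1"
    using c(4) by (metis add.commute add.left_commute diff_add_cancel mult_div_mod_eq)
  have n: "(x + 1 - y) mod 3 = 2" "(x - 1 - y) mod 3 = 0" "(x - (y + 1)) mod 3 = 0"
    "(x - (y - 1)) mod 3 = 2" "(x + 1 - (y - 1)) mod 3 = 0" "(x - 1 - (y + 1)) mod 3 = 2"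
    unfolding t by presburger+
  have v: "(u, v) \<in> vertices d \<longleftrightarrow> 0 \<le> u \<and> 0 \<le> v \<and> u + v \<le> 3 * int k \<and> (u - v) mod 3 \<noteq> 1" for u v
    by (auto simp: vertices_def hex_centres_def patch_def k)
  have mem: "(x + 1, y) \<in> vertices d \<longleftrightarrow> x + y < 3 * int k"
    "(x, y + 1) \<in> vertices d \<longleftrightarrow> x + y < 3 * int k"
    "(x - 1, y) \<in> vertices d \<longleftrightarrow> 0 < x" "(x - 1, y + 1) \<in> vertices d \<longleftrightarrow> 0 < x"
    "(x, y - 1) \<in> vertices d \<longleftrightarrow> 0 < y" "(x + 1, y - 1) \<in> vertices d \<longleftrightarrow> 0 < y"
    using c(1,2,3) unfolding v n by linarith+
  have nb: "neighbours (x, y) = {(x + 1, y), (x, y + 1), (x - 1, y), (x - 1, y + 1), (x, y - 1), (x + 1, y - 1)}"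
    unfolding neighbours_def by auto
  have e: "x = 0 \<longrightarrow> y \<noteq> 0 \<and> x + y \<noteq> 3 * int k" "y = 0 \<longrightarrow> x + y \<noteq> 3 * int k"
    using t by presburger+
  have "x = 0 \<or> 0 < x" "y = 0 \<or> 0 < y" "x + y = 3 * int k \<or> x + y < 3 * int k"
    using c(1,2,3) by auto
  with e consider "x = 0" "0 < y" "x + y < 3 * int k" | "0 < x" "y = 0" "x + y < 3 * int k"
    | "0 < x" "0 < y" "x + y = 3 * int k" | "0 < x" "0 < y" "x + y < 3 * int k"
    by blast
  moreover have "P = (if x + y < 3 * int k then {(x + 1, y), (x, y + 1)} else {})
      \<union> (if 0 < x then {(x - 1, y), (x - 1, y + 1)} else {})
      \<union> (if 0 < y then {(x, y - 1), (x + 1, y - 1)} else {})"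
    unfolding P nb by (simp add: Int_insert_left mem)
  ultimately show ?thesis by cases simp_all
qed


section \<open>Fermionic and qubit blocks\<close>

text \<open>\<open>p x i\<close> is the annihilation operator of site \<open>i\<close> of the fermionic block \<open>x\<close>.\<close>

definition fermion_system ::
    "nat \<Rightarrow> 'f set \<Rightarrow> ('f \<Rightarrow> nat \<Rightarrow> 'h::finite operator) \<Rightarrow> bool" where
  "fermion_system n F p \<longleftrightarrow>
     (\<forall>x\<in>F. \<forall>y\<in>F. \<forall>i\<in>{1..n}. \<forall>j\<in>{1..n}.
        p x i ** p y j + p y j ** p x i = 0 \<and>
        p x i ** dagger (p y j) + dagger (p y j) ** p x i =
          (if x = y \<and> i = j then mat 1 else 0))"

text \<open>\<open>E q i r s\<close> is the operator \<open>|r\<rangle>\<langle>s|\<close> on qubit \<open>i\<close> of block \<open>q\<close> (and the identity on everything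
  else), where \<open>False\<close> and \<open>True\<close> stand for the computational basis states \<open>0\<close> and \<open>1\<close>.\<close>

definition qubit_system ::
    "nat \<Rightarrow> 'q set \<Rightarrow> ('q \<Rightarrow> nat \<Rightarrow> bool \<Rightarrow> bool \<Rightarrow> 'h::finite operator) \<Rightarrow> bool" where
  "qubit_system n Q E \<longleftrightarrow>
     (\<forall>q\<in>Q. \<forall>i\<in>{1..n}.
        (\<forall>r s t u. E q i r s ** E q i t u = (if s = t then E q i r u else 0)) \<and>
        (\<forall>r s. dagger (E q i r s) = E q i s r) \<and>
        E q i False False + E q i True True = mat 1) \<and>
     (\<forall>q\<in>Q. \<forall>q'\<in>Q. \<forall>i\<in>{1..n}. \<forall>j\<in>{1..n}. (q, i) \<noteq> (q', j) \<longrightarrow>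
        (\<forall>r s t u. E q i r s ** E q' j t u = E q' j t u ** E q i r s))"

text \<open>It suffices to require commutation with the annihilation operators, because
  the adjoint of \<open>E q i r s\<close> is \<open>E q i s r\<close>.\<close>

definition qubits_commute_with_fermions ::
    "nat \<Rightarrow> 'f set \<Rightarrow> 'q set \<Rightarrow> ('f \<Rightarrow> nat \<Rightarrow> 'h::finite operator) \<Rightarrow>
     ('q \<Rightarrow> nat \<Rightarrow> bool \<Rightarrow> bool \<Rightarrow> 'h operator) \<Rightarrow> bool" where
  "qubits_commute_with_fermions n F Q p E \<longleftrightarrow>
     (\<forall>x\<in>F. \<forall>q\<in>Q. \<forall>i\<in>{1..n}. \<forall>j\<in>{1..n}. \<forall>r s. E q j r s ** p x i = p x i ** E q j r s)"

text \<open>The Hermitian solutions \<open>\<gamma>\<close>, \<open>\<gamma>'\<close> of \<open>dagger p = (\<gamma> + \<i> \<gamma>') / 2\<close>; \<open>majorana_tilde\<close> is the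
  second one.\<close>

definition majorana :: "('f \<Rightarrow> nat \<Rightarrow> 'h::finite operator) \<Rightarrow> 'f \<Rightarrow> nat \<Rightarrow> 'h operator" where
  "majorana p x i = dagger (p x i) + p x i"

definition majorana_tilde :: "('f \<Rightarrow> nat \<Rightarrow> 'h::finite operator) \<Rightarrow> 'f \<Rightarrow> nat \<Rightarrow> 'h operator" where
  "majorana_tilde p x i = (- \<i>) *\<^sub>C (dagger (p x i) - p x i)"

definition number :: "('f \<Rightarrow> nat \<Rightarrow> 'h::finite operator) \<Rightarrow> 'f \<Rightarrow> nat \<Rightarrow> 'h operator" where
  "number p x i = dagger (p x i) ** p x i"

definition qubit_number ::
    "('q \<Rightarrow> nat \<Rightarrow> bool \<Rightarrow> bool \<Rightarrow> 'h::finite operator) \<Rightarrow> 'q \<Rightarrow> nat \<Rightarrow> 'h operator" where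
  "qubit_number E q i = E q i True True"

definition pauli_X ::
    "('q \<Rightarrow> nat \<Rightarrow> bool \<Rightarrow> bool \<Rightarrow> 'h::finite operator) \<Rightarrow> 'q \<Rightarrow> nat \<Rightarrow> 'h operator" where
  "pauli_X E q i = E q i False True + E q i True False"

definition pauli_Z ::
    "('q \<Rightarrow> nat \<Rightarrow> bool \<Rightarrow> bool \<Rightarrow> 'h::finite operator) \<Rightarrow> 'q \<Rightarrow> nat \<Rightarrow> 'h operator" where
  "pauli_Z E q i = E q i False False - E q i True True"


section \<open>Stabilizers, logical operators and logical gates\<close>

text \<open>Which operator is placed on each site, and on which block.\<close>

datatype ('f, 'q) kind = Maj 'f | MajT 'f | PX 'q | PZ 'q

definition kinds :: "'f set \<Rightarrow> 'q set \<Rightarrow> ('f, 'q) kind set" where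
  "kinds F Q = Maj ` F \<union> MajT ` F \<union> PX ` Q \<union> PZ ` Q"

fun site_op ::
    "('f \<Rightarrow> nat \<Rightarrow> 'h::finite operator) \<Rightarrow> ('q \<Rightarrow> nat \<Rightarrow> bool \<Rightarrow> bool \<Rightarrow> 'h operator) \<Rightarrow>
     ('f, 'q) kind \<Rightarrow> nat \<Rightarrow> 'h operator" where
  "site_op p E (Maj x) i = majorana p x i"
| "site_op p E (MajT x) i = majorana_tilde p x i"
| "site_op p E (PX q) i = pauli_X E q i"
| "site_op p E (PZ q) i = pauli_Z E q i"

text \<open>The stabilizer products are \<open>stabilizer p E (k, S)\<close> for \<open>k\<close> in \<open>kinds F Q\<close> and \<open>S\<close> a
  plaquette.\<close>

definition stabilizer ::
    "('f \<Rightarrow> nat \<Rightarrow> 'h::finite operator) \<Rightarrow> ('q \<Rightarrow> nat \<Rightarrow> bool \<Rightarrow> bool \<Rightarrow> 'h operator) \<Rightarrow>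
     ('f, 'q) kind \<times> nat set \<Rightarrow> 'h operator" where
  "stabilizer p E = (\<lambda>(k, S). site_prod S (site_op p E k))"

definition logical ::
    "nat \<Rightarrow> ('f \<Rightarrow> nat \<Rightarrow> 'h::finite operator) \<Rightarrow> ('q \<Rightarrow> nat \<Rightarrow> bool \<Rightarrow> bool \<Rightarrow> 'h operator) \<Rightarrow>
     ('f, 'q) kind \<Rightarrow> 'h operator" where
  "logical n p E k = site_prod {1..n} (site_op p E k)"

definition logical_ferm_Z ::
    "nat \<Rightarrow> ('f \<Rightarrow> nat \<Rightarrow> 'h::finite operator) \<Rightarrow> ('q \<Rightarrow> nat \<Rightarrow> bool \<Rightarrow> bool \<Rightarrow> 'h operator) \<Rightarrow>
     'f \<Rightarrow> 'h operator" where
  "logical_ferm_Z n p E x = (- \<i>) *\<^sub>C (logical n p E (MajT x) ** logical n p E (Maj x))"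

text \<open>The factors are required to be distinct: the product of six Majorana operators squares
  to \<open>-1\<close>, so with repeated factors allowed every product of stabilizer products would
  also occur with the opposite sign, and the absence of an additional sign would say nothing.\<close>

definition preserves_stabilizers ::
    "nat set set \<Rightarrow> 'f set \<Rightarrow> 'q set \<Rightarrow> ('f \<Rightarrow> nat \<Rightarrow> 'h::finite operator) \<Rightarrow>
     ('q \<Rightarrow> nat \<Rightarrow> bool \<Rightarrow> bool \<Rightarrow> 'h operator) \<Rightarrow> 'h operator \<Rightarrow> bool" where
  "preserves_stabilizers Ps F Q p E U \<longleftrightarrow>
     (\<forall>s \<in> kinds F Q \<times> Ps. \<exists>ss. distinct ss \<and> set ss \<subseteq> kinds F Q \<times> Ps \<and>
        heisenberg U (stabilizer p E s) = foldr (\<lambda>t A. stabilizer p E t ** A) ss (mat 1))"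

text \<open>\<open>L'\<close> gives the image of every logical operator.\<close>

definition logical_gate ::
    "nat set set \<Rightarrow> nat \<Rightarrow> 'f set \<Rightarrow> 'q set \<Rightarrow> ('f \<Rightarrow> nat \<Rightarrow> 'h::finite operator) \<Rightarrow>
     ('q \<Rightarrow> nat \<Rightarrow> bool \<Rightarrow> bool \<Rightarrow> 'h operator) \<Rightarrow> 'h operator \<Rightarrow>
     (('f, 'q) kind \<Rightarrow> 'h operator) \<Rightarrow> bool" where
  "logical_gate Ps n F Q p E U L' \<longleftrightarrow>
     preserves_stabilizers Ps F Q p E U \<and>
     (\<forall>k \<in> kinds F Q. heisenberg U (logical n p E k) = L' k)"


section \<open>Physical gates\<close>

definition BRAID ::
    "('f \<Rightarrow> nat \<Rightarrow> 'h::finite operator) \<Rightarrow> 'f \<Rightarrow> nat \<Rightarrow> 'f \<Rightarrow> nat \<Rightarrow> 'h operator" where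
  "BRAID p x i y j = mexp ((- (pi / 4)) *\<^sub>R (majorana_tilde p x i ** majorana p y j))"

definition S_f :: "('f \<Rightarrow> nat \<Rightarrow> 'h::finite operator) \<Rightarrow> 'f \<Rightarrow> nat \<Rightarrow> 'h operator" where
  "S_f p x i = mexp ((\<i> * of_real (pi / 2)) *\<^sub>C number p x i)"

definition CZ_f ::
    "('f \<Rightarrow> nat \<Rightarrow> 'h::finite operator) \<Rightarrow> 'f \<Rightarrow> nat \<Rightarrow> 'f \<Rightarrow> nat \<Rightarrow> 'h operator" where
  "CZ_f p x i y j = mexp ((- \<i> * of_real pi) *\<^sub>C (number p x i ** number p y j))"

definition CZ_qf ::
    "('f \<Rightarrow> nat \<Rightarrow> 'h::finite operator) \<Rightarrow> ('q \<Rightarrow> nat \<Rightarrow> bool \<Rightarrow> bool \<Rightarrow> 'h operator) \<Rightarrow>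
     'q \<Rightarrow> nat \<Rightarrow> 'f \<Rightarrow> nat \<Rightarrow> 'h operator" where
  "CZ_qf p E q i y j = mexp ((- \<i> * of_real pi) *\<^sub>C (qubit_number E q i ** number p y j))"

end

theory Submission
  imports Defs
begin

text \<open>Each physical gate is \<open>u P + v (1 - P)\<close> for a projection \<open>P\<close> built from bilinears
  \<open>- \<i> \<gamma>' \<gamma>\<close> or Pauli \<open>Z\<close> operators, and a site operator either commutes with such an
  involution or anticommutes with it.  Conjugation by one physical gate follows, and the
  transversal gate acts factor by factor because gates and operators on different sites commute.
  Reordering the resulting product over \<open>m\<close> sites yields the scalar \<open>(-1)\<^sup>m\<close> or
  \<open>(- \<i>)\<^sup>m (-1)\<^bsup>m (m - 1) / 2\<^esup>\<close>.  Both are \<open>1\<close> for \<open>m = 4\<close> and \<open>m = 6\<close>, so stabilizers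
  acquire no sign, whereas for odd \<open>m = n\<close> they equal \<open>-1\<close> and \<open>- \<i>\<close>, as for a single site.\<close>

section \<open>Matrix algebra\<close>

interpretation cscale: vector_space cscale
  by unfold_locales (simp_all add: cscale_def vec_eq_iff algebra_simps)

lemma minus_one_cscale [simp]: "(-1) *\<^sub>C A = - A"
  by (simp add: cscale_def vec_eq_iff)

lemma cscale_mult_left: "(c *\<^sub>C A) ** B = c *\<^sub>C (A ** B)"
  by (simp add: cscale_def vec_eq_iff matrix_matrix_mult_def sum_distrib_left algebra_simps)

lemma cscale_mult_right: "A ** (c *\<^sub>C B) = c *\<^sub>C (A ** B)"
  by (simp add: cscale_def vec_eq_iff matrix_matrix_mult_def sum_distrib_left algebra_simps)

lemma matrix_mult_add_left: "(A + B) ** C = A ** C + B ** (C :: 'h::finite operator)"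
  by (simp add: vec_eq_iff matrix_matrix_mult_def sum.distrib algebra_simps)

lemma matrix_mult_minus:
  "(- A) ** B = - (A ** (B :: 'h::finite operator))" "A ** (- B) = - (A ** B)"
  by (simp_all add: vec_eq_iff matrix_matrix_mult_def sum_negf)

lemma matrix_mult_diff:
  "(A - B) ** C = A ** C - B ** (C :: 'h::finite operator)" "C ** (A - B) = C ** A - C ** B"
  by (simp_all add: vec_eq_iff matrix_matrix_mult_def sum_subtractf algebra_simps)

lemmas operator_distribs = matrix_add_ldistrib matrix_mult_add_left matrix_mult_minus
  matrix_mult_diff cscale_mult_left cscale_mult_right

lemma scaleR_cscale: "r *\<^sub>R A = of_real r *\<^sub>C (A :: 'h::finite operator)"
  by (simp add: cscale_def vec_eq_iff) (simp add: scaleR_conv_of_real)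

lemma dagger_mult: "dagger (A ** B) = dagger B ** dagger A"
  by (simp add: dagger_def vec_eq_iff matrix_matrix_mult_def transpose_def algebra_simps)

lemma dagger_dagger [simp]: "dagger (dagger A) = A"
  by (simp add: dagger_def vec_eq_iff transpose_def)

lemma dagger_linear [simp]:
  "dagger (A + B) = dagger A + dagger B" "dagger (A - B) = dagger A - dagger B"
  "dagger (- A) = - dagger A" "dagger (c *\<^sub>C A) = cnj c *\<^sub>C dagger A"
  "dagger 0 = 0" "dagger (mat 1) = mat 1"
  by (auto simp: dagger_def vec_eq_iff transpose_def cscale_def mat_def)

section \<open>Commutation up to a scalar\<close>

text \<open>One relation covers commuting (\<open>s = 1\<close>) and anticommuting
  (\<open>s = -1\<close>) pairs, so the sign of a whole product is obtained by multiplying the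
  scalars of its factors.\<close>

definition commute_up_to :: "complex \<Rightarrow> 'h::finite operator \<Rightarrow> 'h operator \<Rightarrow> bool" where
  "commute_up_to s A B \<longleftrightarrow> A ** B = s *\<^sub>C (B ** A)"

abbreviation commute :: "'h::finite operator \<Rightarrow> 'h operator \<Rightarrow> bool" where
  "commute \<equiv> commute_up_to 1"

lemma commute_iff: "commute A B \<longleftrightarrow> A ** B = B ** A"
  by (simp add: commute_up_to_def)

lemma commute_up_to_mult_left:
  assumes "commute_up_to s A C" "commute_up_to t B C"
  shows "commute_up_to (s * t) (A ** B) C"
proof -
  have "A ** B ** C = t *\<^sub>C ((A ** C) ** B)"
    using assms(2) by (simp add: commute_up_to_def cscale_mult_right flip: matrix_mul_assoc)
  then show ?thesis
    using assms(1) by (simp add: commute_up_to_def cscale_mult_left matrix_mul_assoc mult.commute)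
qed

lemma commute_up_to_mult_right:
  assumes "commute_up_to s A B" "commute_up_to t A C"
  shows "commute_up_to (s * t) A (B ** C)"
proof -
  have "A ** (B ** C) = s *\<^sub>C (B ** (A ** C))"
    using assms(1) by (simp add: commute_up_to_def cscale_mult_left matrix_mul_assoc)
  then show ?thesis
    using assms(2) by (simp add: commute_up_to_def cscale_mult_right flip: matrix_mul_assoc)
qed

lemma commute_sym: "commute A B \<Longrightarrow> commute B A"
  by (simp add: commute_iff)

lemma commute_mat_1 [simp]: "commute A (mat 1)" "commute (mat 1) A"
  by (simp_all add: commute_iff)

lemma commute_self [simp]: "commute A A"
  by (simp add: commute_iff)

lemma commute_linear:
  "commute A B \<Longrightarrow> commute A C \<Longrightarrow> commute A (B + C)"
  "commute A B \<Longrightarrow> commute A C \<Longrightarrow> commute A (B - C)"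
  "commute A B \<Longrightarrow> commute A (c *\<^sub>C B)"
  by (simp_all add: commute_iff operator_distribs)

lemma commute_mult:
  "commute A B \<Longrightarrow> commute A C \<Longrightarrow> commute A (B ** C)"
  "commute A C \<Longrightarrow> commute B C \<Longrightarrow> commute (A ** B) C"
  using commute_up_to_mult_left[of 1 A C 1 B] commute_up_to_mult_right[of 1 A B 1 C] by simp_all

section \<open>Operators with two spectral values\<close>

definition orthogonal_projection :: "'h::finite operator \<Rightarrow> bool" where
  "orthogonal_projection P \<longleftrightarrow> P ** P = P \<and> dagger P = P"

text \<open>For a projection \<open>P\<close> this is the operator with eigenvalue \<open>u\<close>
  on the range of \<open>P\<close> and \<open>v\<close> on its kernel. All physical gates take this
  form.\<close>

definition spectral :: "complex \<Rightarrow> complex \<Rightarrow> 'h::finite operator \<Rightarrow> 'h operator" where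
  "spectral u v P = u *\<^sub>C P + v *\<^sub>C (mat 1 - P)"

text \<open>The cross terms \<open>P ** (mat 1 - P)\<close> vanish for idempotent \<open>P\<close>,
  so the coefficients multiply separately.\<close>

lemma spectral_mult:
  assumes "P ** P = P"
  shows "spectral u v P ** spectral u' v' P = spectral (u * u') (v * v') P"
  using assms
  by (simp add: spectral_def operator_distribs cscale.scale_right_distrib cscale.scale_right_diff_distrib
      mult.commute)

lemma spectral_1 [simp]: "spectral 1 1 P = mat 1"
  by (simp add: spectral_def)

text \<open>Powers act on the two coefficients separately, so each entry of the exponential series
  is a combination of two scalar exponential series. Uniqueness of the sum identifies it with
  \<open>mexp\<close>.\<close>

lemma mexp_spectral:
  assumes "P ** P = P"
  shows "mexp (spectral u v P) = spectral (exp u) (exp v) P"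
proof -
  have pow: "mpower (spectral u v P) k = spectral (u ^ k) (v ^ k) P" for k
    by (induction k) (simp_all add: spectral_mult[OF assms])
  have exps: "(\<lambda>k. u ^ k /\<^sub>R fact k) sums exp u" for u :: complex
    by (rule exp_converges)
  have "(\<lambda>k. (1 / fact k) *\<^sub>R mpower (spectral u v P) k) sums spectral (exp u) (exp v) P"
    unfolding sums_def
  proof (intro vec_tendstoI)
    fix i j
    have "(\<lambda>k. ((1 / fact k) *\<^sub>R mpower (spectral u v P) k) $ i $ j) sums
        (exp u * P $ i $ j + exp v * (mat 1 - P) $ i $ j)"
      using sums_add[OF sums_mult2[OF exps[of u], of "P $ i $ j"]
          sums_mult2[OF exps[of v], of "(mat 1 - P) $ i $ j"]]
      by (simp add: pow) (simp add: spectral_def cscale_def scaleR_add_right divide_inverse)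
    then show "(\<lambda>N. (\<Sum>k<N. (1 / fact k) *\<^sub>R mpower (spectral u v P) k) $ i $ j)
        \<longlonglongrightarrow> spectral (exp u) (exp v) P $ i $ j"
      by (simp add: sums_def spectral_def cscale_def)
  qed
  with mexp_sums show ?thesis by (rule sums_unique2)
qed

lemma dagger_spectral:
  "dagger P = P \<Longrightarrow> dagger (spectral u v P) = spectral (cnj u) (cnj v) P"
  by (simp add: spectral_def)

lemma mult_spectral:
  fixes A :: "'h::finite operator"
  assumes "A ** P = P' ** A"
  shows "A ** spectral u v P = spectral u v P' ** A"
  using assms by (simp add: spectral_def operator_distribs)

lemma spectral_complement: "spectral u v (mat 1 - P) = spectral v u P"
  by (simp add: spectral_def add.commute)

lemma commute_spectral: "commute A P \<Longrightarrow> commute A (spectral u v P)"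
  unfolding spectral_def by (intro commute_linear) auto

section \<open>Unitaries and Heisenberg conjugation\<close>

definition unitary :: "'h::finite operator \<Rightarrow> bool" where
  "unitary U \<longleftrightarrow> dagger U ** U = mat 1 \<and> U ** dagger U = mat 1"

lemma unitary_mult: "unitary U \<Longrightarrow> unitary V \<Longrightarrow> unitary (U ** V)"
  unfolding unitary_def dagger_mult by (metis matrix_mul_assoc matrix_mul_lid)

lemma unitary_spectral:
  assumes "orthogonal_projection P" "cnj u * u = 1" "cnj v * v = 1"
  shows "unitary (spectral u v P)"
  using assms by (simp add: unitary_def orthogonal_projection_def dagger_spectral spectral_mult mult.commute)

lemma heisenberg_commute: "unitary U \<Longrightarrow> commute A U \<Longrightarrow> heisenberg U A = A"
  by (simp add: heisenberg_def unitary_def commute_iff flip: matrix_mul_assoc)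
    (simp add: matrix_mul_assoc)

lemma heisenberg_mult:
  assumes "unitary U"
  shows "heisenberg U (A ** B) = heisenberg U A ** heisenberg U B"
proof -
  have "dagger U ** A ** U ** (dagger U ** B ** U) = dagger U ** A ** (U ** dagger U) ** B ** U"
    by (simp add: matrix_mul_assoc)
  moreover have "U ** dagger U = mat 1"
    using assms by (simp add: unitary_def)
  ultimately show ?thesis
    by (simp add: heisenberg_def matrix_mul_assoc)
qed

lemma heisenberg_prod: "heisenberg (U ** V) A = heisenberg V (heisenberg U A)"
  by (simp add: heisenberg_def dagger_mult matrix_mul_assoc)

lemma heisenberg_one: "unitary U \<Longrightarrow> heisenberg U (mat 1) = mat 1"
  by (simp add: heisenberg_def unitary_def)

text \<open>Since \<open>A\<close> exchanges the range of \<open>P\<close> with its complement,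
  moving \<open>A\<close> to the right past the gate swaps \<open>u\<close> and \<open>v\<close>.
  What remains on the left is the adjoint gate times the swapped gate.\<close>

lemma heisenberg_spectral_flip:
  assumes "orthogonal_projection P" "A ** P = (mat 1 - P) ** A"
  shows "heisenberg (spectral u v P) A = spectral (cnj u * v) (cnj v * u) P ** A"
proof -
  have "heisenberg (spectral u v P) A = (spectral (cnj u) (cnj v) P ** spectral v u P) ** A"
    using assms mult_spectral[OF assms(2), of u v] unfolding heisenberg_def
    by (simp add: orthogonal_projection_def dagger_spectral spectral_complement flip: matrix_mul_assoc)
  then show ?thesis
    using assms by (simp add: orthogonal_projection_def spectral_mult)
qed

lemma orthogonal_projection_mult:
  assumes "orthogonal_projection M" "orthogonal_projection N" "commute M N"
  shows "orthogonal_projection (M ** N)"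
  using assms unfolding orthogonal_projection_def commute_iff dagger_mult
  by (metis matrix_mul_assoc)

text \<open>Moving \<open>A\<close> past the gate turns \<open>M ** N\<close> into
  \<open>(mat 1 - M) ** N\<close>. These are complementary parts of \<open>N\<close>, so the two
  reflections multiply to the reflection in \<open>N\<close> alone.\<close>

lemma heisenberg_controlled_phase:
  assumes M: "orthogonal_projection M" and N: "orthogonal_projection N" and MN: "commute M N"
    and A: "A ** M = (mat 1 - M) ** A" "commute A N"
  shows "heisenberg (spectral (-1) 1 (M ** N)) A = spectral (-1) 1 N ** A"
proof -
  let ?W = "spectral (-1) 1 :: 'a operator \<Rightarrow> 'a operator"
  have P: "orthogonal_projection (M ** N)"
    using M N MN by (rule orthogonal_projection_mult)
  have "A ** (M ** N) = ((mat 1 - M) ** N) ** A"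
    using A by (metis commute_iff matrix_mul_assoc)
  then have "A ** ?W (M ** N) = ?W ((mat 1 - M) ** N) ** A"
    by (rule mult_spectral)
  then have "heisenberg (?W (M ** N)) A = (?W (M ** N) ** ?W ((mat 1 - M) ** N)) ** A"
    using P by (simp add: heisenberg_def orthogonal_projection_def dagger_spectral flip: matrix_mul_assoc)
  moreover have "?W (M ** N) ** ?W ((mat 1 - M) ** N) = ?W N"
  proof -
    \<comment> \<open>Orthogonality of the two parts removes the quadratic term in the product of
      the reflections.\<close>
    have "(M ** N) ** ((mat 1 - M) ** N) = 0"
    proof -
      have "M ** N ** M ** N = M ** N"
        using P by (simp add: orthogonal_projection_def matrix_mul_assoc)
      moreover have "M ** N ** N = M ** N"
        using N by (simp add: orthogonal_projection_def flip: matrix_mul_assoc)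
      ultimately show ?thesis by (simp add: operator_distribs matrix_mul_assoc)
    qed
    \<comment> \<open>Expanded for arbitrary \<open>K\<close>; the case of interest is
      \<open>K = (mat 1 - M) ** N\<close>, where the last term is zero and the linear terms add up
      to \<open>2 *\<^sub>C N\<close>.\<close>
    moreover have "?W (M ** N) ** ?W K = mat 1 - 2 *\<^sub>C (M ** N) - 2 *\<^sub>C K + 4 *\<^sub>C ((M ** N) ** K)" for K
    proof -
      have W: "?W P = mat 1 - 2 *\<^sub>C P" for P
        by (simp add: spectral_def cscale_def vec_eq_iff)
      show ?thesis unfolding W
        by (simp add: operator_distribs cscale.scale_right_diff_distrib algebra_simps)
    qed
    ultimately show ?thesis
      by (simp add: spectral_def operator_distribs) (simp add: cscale_def vec_eq_iff)
  qed
  ultimately show ?thesis by simp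
qed

section \<open>Ordered products and logical gates\<close>

definition op_prod :: "('i \<Rightarrow> 'h::finite operator) \<Rightarrow> 'i list \<Rightarrow> 'h operator" where
  "op_prod f xs = foldr (\<lambda>i A. f i ** A) xs (mat 1)"

lemma op_prod_simps [simp]:
  "op_prod f [] = mat 1" "op_prod f (x # xs) = f x ** op_prod f xs"
  by (simp_all add: op_prod_def)

lemma site_prod_eq_op_prod: "site_prod S f = op_prod f (sorted_list_of_set S)"
  by (simp add: site_prod_def op_prod_def)

lemma op_prod_cong: "(\<And>x. x \<in> set xs \<Longrightarrow> f x = g x) \<Longrightarrow> op_prod f xs = op_prod g xs"
  by (induction xs) auto

lemma commute_up_to_op_prod:
  assumes "\<And>x. x \<in> set xs \<Longrightarrow> commute_up_to s A (f x)"
  shows "commute_up_to (s ^ length xs) A (op_prod f xs)"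
  using assms by (induction xs) (auto intro!: commute_up_to_mult_right)

lemma commute_op_prod: "(\<And>x. x \<in> set xs \<Longrightarrow> commute A (f x)) \<Longrightarrow> commute A (op_prod f xs)"
  using commute_up_to_op_prod[of xs 1 A f] by simp

lemma unitary_op_prod: "(\<And>x. x \<in> set xs \<Longrightarrow> unitary (U x)) \<Longrightarrow> unitary (op_prod U xs)"
proof (induction xs)
  case Nil
  then show ?case by (simp add: unitary_def)
qed (auto intro: unitary_mult)

lemma heisenberg_op_prod:
  "unitary U \<Longrightarrow> heisenberg U (op_prod f xs) = op_prod (\<lambda>i. heisenberg U (f i)) xs"
  by (induction xs) (auto simp: heisenberg_mult heisenberg_one)

lemma op_prod_cscale: "op_prod (\<lambda>i. c *\<^sub>C f i) xs = c ^ length xs *\<^sub>C op_prod f xs"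
  by (induction xs) (simp_all add: cscale_mult_left cscale_mult_right)

text \<open>To bring all \<open>A\<close> factors to the left, each \<open>B i\<close> crosses the
  \<open>A j\<close> of the later positions: \<open>m (m - 1) / 2\<close> crossings for
  \<open>m\<close> positions, each costing \<open>s\<close>. Factors with the same index never
  cross, so the hypothesis speaks of \<open>i \<noteq> j\<close> only.\<close>

lemma op_prod_interleave:
  assumes "distinct xs"
    and "\<And>i j. i \<in> set xs \<Longrightarrow> j \<in> set xs \<Longrightarrow> i \<noteq> j \<Longrightarrow> commute_up_to s (B i) (A j)"
  shows "op_prod (\<lambda>i. A i ** B i) xs =
    s ^ (length xs * (length xs - 1) div 2) *\<^sub>C (op_prod A xs ** op_prod B xs)"
  using assms
proof (induction xs)
  case Nil
  then show ?case by simp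
next
  case (Cons x xs)
  let ?m = "length xs"
  let ?t = "?m * (?m - 1) div 2"
  \<comment> \<open>Recurrence of the triangular numbers: a new first position adds
    \<open>?m\<close> crossings.\<close>
  have e: "Suc ?m * (Suc ?m - 1) div 2 = ?t + ?m"
  proof -
    have "Suc ?m * (Suc ?m - 1) = ?m * (?m - 1) + 2 * ?m"
      by (cases ?m) (simp_all add: algebra_simps)
    then show ?thesis by (metis div_mult_self4 add.commute zero_neq_numeral)
  qed
  have "commute_up_to (s ^ ?m) (B x) (op_prod A xs)"
    by (rule commute_up_to_op_prod) (use Cons.prems in auto)
  then have sw: "B x ** op_prod A xs = s ^ ?m *\<^sub>C (op_prod A xs ** B x)"
    by (simp add: commute_up_to_def)
  have "op_prod (\<lambda>i. A i ** B i) (x # xs) = s ^ ?t *\<^sub>C (A x ** (B x ** op_prod A xs) ** op_prod B xs)"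
    using Cons.IH Cons.prems by (simp add: cscale_mult_right matrix_mul_assoc)
  also have "\<dots> = s ^ (?t + ?m) *\<^sub>C (op_prod A (x # xs) ** op_prod B (x # xs))"
    unfolding sw by (simp add: cscale_mult_left cscale_mult_right matrix_mul_assoc power_add)
  finally show ?case
    unfolding length_Cons e .
qed

text \<open>The leftmost factor of the gate acts first. Factors before \<open>U i\<close> must
  therefore commute with \<open>A\<close>, and factors after it with the image of \<open>A\<close>,
  which explains the two commutation hypotheses.\<close>

lemma heisenberg_by_op_prod:
  assumes "distinct xs" "\<And>j. j \<in> set xs \<Longrightarrow> unitary (U j)"
    and "\<And>j. j \<in> set xs \<Longrightarrow> j \<noteq> i \<Longrightarrow> commute A (U j)"
    and "\<And>j. j \<in> set xs \<Longrightarrow> j \<noteq> i \<Longrightarrow> commute (heisenberg (U i) A) (U j)"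
  shows "heisenberg (op_prod U xs) A = (if i \<in> set xs then heisenberg (U i) A else A)"
  using assms
proof (induction xs)
  case Nil
  then show ?case by (simp add: heisenberg_def)
next
  case (Cons x xs)
  show ?case
  proof (cases "x = i")
    case True
    have "unitary (op_prod U xs)" by (rule unitary_op_prod) (use Cons.prems in auto)
    moreover have "commute (heisenberg (U i) A) (op_prod U xs)"
      by (rule commute_op_prod) (use Cons.prems True in auto)
    ultimately show ?thesis using True by (simp add: heisenberg_prod heisenberg_commute)
  next
    case False
    then have "heisenberg (U x) A = A"
      using Cons.prems by (auto intro: heisenberg_commute)
    then show ?thesis using Cons False by (auto simp: heisenberg_prod)
  qed
qed

text \<open>Conjugation by a unitary is multiplicative, so the whole gate acts on each factor
  \<open>A i\<close> separately, and there only \<open>U i\<close> is felt.\<close>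

lemma heisenberg_site_prod:
  assumes "S \<subseteq> {1..n}" "\<And>j. j \<in> {1..n} \<Longrightarrow> unitary (U j)"
    and "\<And>i j. i \<in> {1..n} \<Longrightarrow> j \<in> {1..n} \<Longrightarrow> j \<noteq> i \<Longrightarrow> commute (A i) (U j)"
    and "\<And>i j. i \<in> {1..n} \<Longrightarrow> j \<in> {1..n} \<Longrightarrow> j \<noteq> i \<Longrightarrow> commute (heisenberg (U i) (A i)) (U j)"
  shows "heisenberg (site_prod {1..n} U) (site_prod S A) = site_prod S (\<lambda>i. heisenberg (U i) (A i))"
proof -
  let ?xs = "sorted_list_of_set {1..n}"
  have xs: "distinct ?xs" "set ?xs = {1..n}" by simp_all
  have S: "set (sorted_list_of_set S) = S"
    using assms(1) finite_subset by (intro set_sorted_list_of_set) blast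
  have "unitary (op_prod U ?xs)"
    by (rule unitary_op_prod) (use assms(2) xs in blast)
  then have "heisenberg (op_prod U ?xs) (op_prod A (sorted_list_of_set S)) =
      op_prod (\<lambda>i. heisenberg (op_prod U ?xs) (A i)) (sorted_list_of_set S)"
    by (rule heisenberg_op_prod)
  also have "\<dots> = op_prod (\<lambda>i. heisenberg (U i) (A i)) (sorted_list_of_set S)"
  proof (rule op_prod_cong)
    fix i assume "i \<in> set (sorted_list_of_set S)"
    then have "i \<in> set ?xs" unfolding S xs using assms(1) by blast
    then show "heisenberg (op_prod U ?xs) (A i) = heisenberg (U i) (A i)"
      using assms(2-4) unfolding xs
      by (subst heisenberg_by_op_prod[OF xs(1), unfolded xs(2)]) auto
  qed
  finally show ?thesis unfolding site_prod_eq_op_prod .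
qed

text \<open>Stabilizers and logical operators are treated together: the word \<open>w\<close> does
  not depend on \<open>S\<close>, and the scalar depends only on \<open>card S\<close>. Plaquettes
  see \<open>c 4\<close> or \<open>c 6\<close>, the full block sees \<open>c n\<close>.\<close>

lemma logical_gateI:
  assumes Ps: "\<And>S. S \<in> Ps \<Longrightarrow> S \<subseteq> {1..n} \<and> card S \<in> {4, 6}"
    and im: "\<And>k. k \<in> kinds F Q \<Longrightarrow> \<exists>w c. distinct w \<and> set w \<subseteq> kinds F Q \<and> c 4 = 1 \<and> c 6 = 1 \<and>
        (\<forall>S\<subseteq>{1..n}. heisenberg U (site_prod S (site_op p E k)) =
          c (card S) *\<^sub>C op_prod (\<lambda>t. site_prod S (site_op p E t)) w) \<and>
        L' k = c n *\<^sub>C op_prod (logical n p E) w"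
  shows "logical_gate Ps n F Q p E U L'"
  unfolding logical_gate_def preserves_stabilizers_def
proof (intro conjI ballI)
  fix s assume "s \<in> kinds F Q \<times> Ps"
  then obtain k S where s: "s = (k, S)" and k: "k \<in> kinds F Q" and S: "S \<in> Ps"
    by blast
  obtain w c where w: "distinct w" "set w \<subseteq> kinds F Q" and c: "c (4::nat) = 1" "c 6 = 1"
    and eq: "\<And>S. S \<subseteq> {1..n} \<Longrightarrow> heisenberg U (site_prod S (site_op p E k)) =
          c (card S) *\<^sub>C op_prod (\<lambda>t. site_prod S (site_op p E t)) w"
    using im[OF k] by blast
  have "heisenberg U (stabilizer p E s) = op_prod (\<lambda>t. site_prod S (site_op p E t)) w"
    using Ps[OF S] c eq by (auto simp: s stabilizer_def)
  also have "\<dots> = foldr (\<lambda>t A. stabilizer p E t ** A) (map (\<lambda>t. (t, S)) w) (mat 1)"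
    by (simp add: op_prod_def foldr_map stabilizer_def o_def)
  finally show "\<exists>ss. distinct ss \<and> set ss \<subseteq> kinds F Q \<times> Ps \<and>
      heisenberg U (stabilizer p E s) = foldr (\<lambda>t A. stabilizer p E t ** A) ss (mat 1)"
    \<comment> \<open>All factors sit on the same plaquette \<open>S\<close>; they are distinct
      because the kinds in \<open>w\<close> are.\<close>
    using w S by (intro exI[of _ "map (\<lambda>t. (t, S)) w"]) (auto simp: distinct_map inj_on_def)
next
  fix k assume k: "k \<in> kinds F Q"
  show "heisenberg U (logical n p E k) = L' k"
  proof -
    obtain w c where eq: "\<And>S. S \<subseteq> {1..n} \<Longrightarrow> heisenberg U (site_prod S (site_op p E k)) =
          c (card S) *\<^sub>C op_prod (\<lambda>t. site_prod S (site_op p E t)) w"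
      and L': "L' k = c n *\<^sub>C op_prod (logical n p E) w"
      using im[OF k] by blast
    show ?thesis
      \<comment> \<open>Here \<open>S\<close> is the whole block \<open>{1..n}\<close>.\<close>
      using eq[OF order_refl] by (simp add: L' logical_def op_prod_def)
  qed
qed

section \<open>Site counts and the phases they produce\<close>

text \<open>The numbering is injective and reaches every vertex, so the plaquette sizes in the
  lattice carry over to sets of sites.\<close>

lemma card_site_plaquette:
  assumes "odd d" "bij_betw vert {1..n} (vertices d)" "S \<in> site_plaquettes d n vert"
  shows "S \<subseteq> {1..n} \<and> card S \<in> {4, 6}"
proof -
  obtain P where P: "P \<in> plaquettes d" and S: "S = {i \<in> {1..n}. vert i \<in> P}"
    using assms(3) by (auto simp: site_plaquettes_def)
  have sub: "S \<subseteq> {1..n}" unfolding S by blast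
  have im: "vert ` {1..n} = vertices d" and inj: "inj_on vert {1..n}"
    using assms(2) by (simp_all add: bij_betw_def)
  have "P \<subseteq> vertices d" using P by (auto simp: plaquettes_def)
  then have "vert ` S = P" unfolding S im[symmetric] by blast
  moreover have "card (vert ` S) = card S"
    using inj sub by (intro card_image) (rule inj_on_subset)
  ultimately show ?thesis using card_plaquette[OF assms(1) P] sub by simp
qed

text \<open>With \<open>d = 2 * k + 1\<close> the count is \<open>3 * (k * (k + 1)) + 1\<close>, and
  \<open>k * (k + 1)\<close> is even.\<close>

lemma odd_number_of_sites:
  fixes d n :: nat
  assumes "odd d" "n = (3 * d\<^sup>2 + 1) div 4"
  shows "odd n"
proof -
  obtain k where "d = 2 * k + 1" using assms by (elim oddE)
  then have "3 * d\<^sup>2 + 1 = 4 * (3 * (k * (k + 1)) + 1)" by (simp add: power2_eq_square algebra_simps)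
  then have "n = 3 * (k * (k + 1)) + 1" using assms(2) by simp
  then show ?thesis by simp
qed

text \<open>The scalar produced by collecting \<open>m\<close> factors \<open>- \<i> \<gamma>'\<^sub>j \<gamma>\<^sub>j\<close> into
  \<open>(\<gamma>'\<^sub>1 \<dots> \<gamma>'\<^sub>m) (\<gamma>\<^sub>1 \<dots> \<gamma>\<^sub>m)\<close>.\<close>

definition pairing_phase :: "nat \<Rightarrow> complex" where
  "pairing_phase m = (- \<i>) ^ m * (-1) ^ (m * (m - 1) div 2)"

text \<open>For four sites both factors of the phase are \<open>1\<close>; for six sites both are
  \<open>-1\<close>.\<close>

lemma pairing_phase_4_6: "pairing_phase 4 = 1" "pairing_phase 6 = 1"
proof -
  have "(- \<i>) ^ 4 = ((- \<i>)\<^sup>2)\<^sup>2" "(- \<i>) ^ 6 = ((- \<i>)\<^sup>2) ^ 3"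
    by (simp_all flip: power_mult)
  then show "pairing_phase 4 = 1" "pairing_phase 6 = 1"
    by (simp_all add: pairing_phase_def)
qed

text \<open>For \<open>m = 2 * j + 1\<close> the power of \<open>- \<i>\<close> contributes
  \<open>(-1) ^ j\<close> beyond a single \<open>- \<i>\<close>, and the crossings contribute
  \<open>(-1) ^ j\<close> once more, so the signs cancel.\<close>

lemma pairing_phase_odd:
  assumes "odd m"
  shows "pairing_phase m = - \<i>"
proof -
  obtain j where m: "m = 2 * j + 1" using assms by (elim oddE)
  have "m * (m - 1) div 2 = j * (2 * j + 1)" by (simp add: m)
  moreover have "(-1 :: complex) ^ (j * (2 * j + 1)) = (-1) ^ j"
    by (auto simp: minus_one_power_iff)
  moreover have "(- \<i>) ^ m = (-1) ^ j * (- \<i>)"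
    by (simp add: m power_mult)
  moreover have "(-1 :: complex) ^ j * (-1) ^ j = 1"
    by (simp flip: power_add mult_2)
  ultimately show ?thesis by (simp add: pairing_phase_def)
qed

lemma site_prod_cong: "finite S \<Longrightarrow> (\<And>i. i \<in> S \<Longrightarrow> f i = g i) \<Longrightarrow> site_prod S f = site_prod S g"
  unfolding site_prod_eq_op_prod by (rule op_prod_cong) simp

section \<open>Projections of involutions\<close>

definition involution :: "'h::finite operator \<Rightarrow> bool" where
  "involution Z \<longleftrightarrow> Z ** Z = mat 1 \<and> dagger Z = Z"

text \<open>For an involution \<open>Z\<close> this projects onto its eigenspace for
  \<open>-1\<close>. Number operators and the qubit state 1 arise this way.\<close>

definition minus_projection :: "'h::finite operator \<Rightarrow> 'h operator" where
  "minus_projection Z = (1/2) *\<^sub>C (mat 1 - Z)"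

lemma orthogonal_projection_minus:
  "involution Z \<Longrightarrow> orthogonal_projection (minus_projection Z)"
  by (simp add: involution_def orthogonal_projection_def minus_projection_def operator_distribs)
    (simp add: vec_eq_iff cscale_def field_simps)

text \<open>An operator that anticommutes with \<open>Z\<close> exchanges the two
  eigenspaces.\<close>

lemma minus_projection_flip:
  assumes "commute_up_to (-1) A Z"
  shows "A ** minus_projection Z = (mat 1 - minus_projection Z) ** A"
proof -
  have "A ** Z = - (Z ** A)" using assms by (simp add: commute_up_to_def)
  then show ?thesis
    by (simp add: minus_projection_def operator_distribs) (simp add: vec_eq_iff cscale_def field_simps)
qed

lemma commute_minus_projection: "commute A Z \<Longrightarrow> commute A (minus_projection Z)"
  unfolding minus_projection_def by (intro commute_linear) auto

lemma spectral_minus_projection: "spectral (-1) 1 (minus_projection Z) = Z"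
  by (simp add: spectral_def minus_projection_def vec_eq_iff cscale_def field_simps)

lemma mexp_cscale_projection:
  assumes "orthogonal_projection P"
  shows "mexp (c *\<^sub>C P) = spectral (exp c) 1 P"
  using mexp_spectral[of P c 0] assms by (simp add: orthogonal_projection_def spectral_def)

text \<open>The controlled Z gate in terms of two commuting involutions: a sign on their joint
  \<open>-1\<close> eigenspace. Both CZ gates are instances.\<close>

definition controlled_sign :: "'h::finite operator \<Rightarrow> 'h operator \<Rightarrow> 'h operator" where
  "controlled_sign Z1 Z2 = spectral (-1) 1 (minus_projection Z1 ** minus_projection Z2)"

lemma commute_controlled_sign:
  "commute A Z1 \<Longrightarrow> commute A Z2 \<Longrightarrow> commute A (controlled_sign Z1 Z2)"
  unfolding controlled_sign_def by (intro commute_spectral commute_mult commute_minus_projection)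

lemma commute_minus_projections:
  "commute Z1 Z2 \<Longrightarrow> commute (minus_projection Z1) (minus_projection Z2)"
  by (rule commute_minus_projection[OF commute_sym[OF commute_minus_projection[OF commute_sym]]])

lemma unitary_controlled_sign:
  assumes "involution Z1" "involution Z2" "commute Z1 Z2"
  shows "unitary (controlled_sign Z1 Z2)"
  unfolding controlled_sign_def using assms
  by (intro unitary_spectral orthogonal_projection_mult orthogonal_projection_minus
      commute_minus_projections) auto

lemma controlled_sign_commute: "commute Z1 Z2 \<Longrightarrow> controlled_sign Z1 Z2 = controlled_sign Z2 Z1"
  using commute_minus_projections[of Z1 Z2] by (simp add: controlled_sign_def commute_iff)

text \<open>An operator that flips the control \<open>Z1\<close> picks up the reflection in the
  \<open>-1\<close> eigenspace of \<open>Z2\<close>, which is \<open>Z2\<close> itself.\<close>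

lemma heisenberg_controlled_sign:
  assumes "involution Z1" "involution Z2" "commute Z1 Z2"
    and "commute_up_to (-1) A Z1" "commute A Z2"
  shows "heisenberg (controlled_sign Z1 Z2) A = Z2 ** A"
proof -
  have "heisenberg (controlled_sign Z1 Z2) A = spectral (-1) 1 (minus_projection Z2) ** A"
    unfolding controlled_sign_def
    by (rule heisenberg_controlled_phase[OF orthogonal_projection_minus[OF assms(1)]
          orthogonal_projection_minus[OF assms(2)] commute_minus_projections[OF assms(3)]
          minus_projection_flip[OF assms(4)] commute_minus_projection[OF assms(5)]])
  then show ?thesis by (simp add: spectral_minus_projection)
qed

lemma mexp_controlled_sign:
  assumes "involution Z1" "involution Z2" "commute Z1 Z2"
  shows "mexp ((- \<i> * of_real pi) *\<^sub>C (minus_projection Z1 ** minus_projection Z2)) = controlled_sign Z1 Z2"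
proof -
  have "exp (- \<i> * of_real pi) = -1"
    by (simp add: exp_minus flip: cis_conv_exp)
  moreover have "orthogonal_projection (minus_projection Z1 ** minus_projection Z2)"
    using assms by (intro orthogonal_projection_mult orthogonal_projection_minus commute_minus_projections)
  ultimately show ?thesis
    using mexp_cscale_projection[of _ "- \<i> * of_real pi"] by (simp only: controlled_sign_def)
qed

section \<open>Fermionic and qubit site operators\<close>

definition fermionic_kinds :: "'f set \<Rightarrow> ('f, 'q) kind set" where
  "fermionic_kinds F = Maj ` F \<union> MajT ` F"

text \<open>With \<open>t = MajT x\<close> and \<open>u = Maj x\<close> this is the fermionic Z of a
  site; with \<open>t = MajT a\<close> and \<open>u = Maj b\<close> it is the generator of a braid
  up to a scalar. Keeping \<open>t\<close> and \<open>u\<close> free covers both.\<close>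

definition parity ::
    "('f \<Rightarrow> nat \<Rightarrow> 'h::finite operator) \<Rightarrow> ('q \<Rightarrow> nat \<Rightarrow> bool \<Rightarrow> bool \<Rightarrow> 'h operator) \<Rightarrow>
     ('f, 'q) kind \<Rightarrow> ('f, 'q) kind \<Rightarrow> nat \<Rightarrow> 'h operator" where
  "parity p E t u i = (- \<i>) *\<^sub>C (site_op p E t i ** site_op p E u i)"

text \<open>Both Majorana operators are combinations of \<open>dagger p\<close> and
  \<open>p\<close>, so a single bilinear expansion yields all their anticommutators; only the mixed
  terms survive.\<close>

lemma anticommutator_expand:
  assumes "P ** R + R ** P = 0" "dagger P ** dagger R + dagger R ** dagger P = 0"
    and "P ** dagger R + dagger R ** P = D" "dagger P ** R + R ** dagger P = D"
  shows "(s *\<^sub>C dagger P + t *\<^sub>C P) ** (s' *\<^sub>C dagger R + t' *\<^sub>C R)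
      + (s' *\<^sub>C dagger R + t' *\<^sub>C R) ** (s *\<^sub>C dagger P + t *\<^sub>C P) = (s * t' + t * s') *\<^sub>C D"
proof -
  have "(s *\<^sub>C dagger P + t *\<^sub>C P) ** (s' *\<^sub>C dagger R + t' *\<^sub>C R)
      + (s' *\<^sub>C dagger R + t' *\<^sub>C R) ** (s *\<^sub>C dagger P + t *\<^sub>C P)
    = (t * t') *\<^sub>C (P ** R + R ** P) + (s * s') *\<^sub>C (dagger P ** dagger R + dagger R ** dagger P)
      + (t * s') *\<^sub>C (P ** dagger R + dagger R ** P) + (s * t') *\<^sub>C (dagger P ** R + R ** dagger P)"
    by (simp add: operator_distribs cscale.scale_right_distrib algebra_simps)
  then show ?thesis
    unfolding assms by (simp add: cscale.scale_left_distrib add.commute)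
qed

locale code_blocks =
  fixes n :: nat and F :: "'f set" and Q :: "'q set"
    and p :: "'f \<Rightarrow> nat \<Rightarrow> 'h::finite operator"
    and E :: "'q \<Rightarrow> nat \<Rightarrow> bool \<Rightarrow> bool \<Rightarrow> 'h operator"
  assumes fermions: "fermion_system n F p"
    and qubits: "qubit_system n Q E"
    and mixed: "qubits_commute_with_fermions n F Q p E"
begin

abbreviation "site \<equiv> site_op p E"
abbreviation "par \<equiv> parity p E"
abbreviation ferm :: "('f, 'q) kind set" where "ferm \<equiv> fermionic_kinds F"
abbreviation "logic \<equiv> logical n p E"

lemma anticommutator:
  assumes x: "x \<in> F" "i \<in> {1..n}" and y: "y \<in> F" "j \<in> {1..n}"
  shows "(s *\<^sub>C dagger (p x i) + t *\<^sub>C p x i) ** (s' *\<^sub>C dagger (p y j) + t' *\<^sub>C p y j)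
      + (s' *\<^sub>C dagger (p y j) + t' *\<^sub>C p y j) ** (s *\<^sub>C dagger (p x i) + t *\<^sub>C p x i)
    = (if x = y \<and> i = j then (s * t' + t * s') *\<^sub>C mat 1 else 0)"
proof -
  have car: "p x i ** p y j + p y j ** p x i = 0"
      "p x i ** dagger (p y j) + dagger (p y j) ** p x i = (if x = y \<and> i = j then mat 1 else 0)"
      "p y j ** dagger (p x i) + dagger (p x i) ** p y j = (if x = y \<and> i = j then mat 1 else 0)"
    using fermions x y unfolding fermion_system_def by auto
  have "dagger (p x i) ** dagger (p y j) + dagger (p y j) ** dagger (p x i) = 0"
    using arg_cong[OF car(1), of dagger] by (simp add: dagger_mult add.commute)
  then show ?thesis
    using anticommutator_expand[OF car(1) _ car(2), of s t s' t'] car(3)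
    by (simp add: add.commute)
qed

lemma ferm_cases:
  assumes "k \<in> ferm"
  obtains x where "x \<in> F" "k = Maj x" "\<And>i. site k i = 1 *\<^sub>C dagger (p x i) + 1 *\<^sub>C p x i"
  | x where "x \<in> F" "k = MajT x" "\<And>i. site k i = (- \<i>) *\<^sub>C dagger (p x i) + \<i> *\<^sub>C p x i"
  using assms
  by (auto simp: fermionic_kinds_def majorana_def majorana_tilde_def cscale.scale_right_diff_distrib)

text \<open>The scalar \<open>s * t' + t * s'\<close> from \<open>anticommutator\<close> is
  \<open>2\<close> for two operators of the same type, and \<open>\<i> - \<i> = 0\<close> for a
  \<open>Maj\<close> with a \<open>MajT\<close>.\<close>

lemma ferm_anticommutator:
  assumes "k \<in> ferm" "l \<in> ferm" "i \<in> {1..n}" "j \<in> {1..n}"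
  shows "site k i ** site l j + site l j ** site k i = (if k = l \<and> i = j then 2 *\<^sub>C mat 1 else 0)"
  by (rule ferm_cases[OF assms(1)]; rule ferm_cases[OF assms(2)])
    (simp_all only: anticommutator assms(3,4), auto)

lemma ferm_anticommute:
  assumes "k \<in> ferm" "l \<in> ferm" "i \<in> {1..n}" "j \<in> {1..n}" "(k, i) \<noteq> (l, j)"
  shows "commute_up_to (-1) (site k i) (site l j)"
  using ferm_anticommutator[OF assms(1-4)] assms(5)
  by (auto simp: commute_up_to_def eq_neg_iff_add_eq_0)

lemma ferm_square:
  assumes "k \<in> ferm" "i \<in> {1..n}"
  shows "site k i ** site k i = mat 1"
  using ferm_anticommutator[OF assms(1,1,2,2)] by (simp add: cscale_def vec_eq_iff)

lemma ferm_hermitian: "k \<in> ferm \<Longrightarrow> dagger (site k i) = site k i"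
  by (erule ferm_cases) (simp_all add: add.commute)

lemma ferm_in_kinds: "k \<in> ferm \<Longrightarrow> k \<in> kinds F Q"
  by (auto simp: fermionic_kinds_def kinds_def)

lemma qubit_commute_ferm:
  assumes "k \<in> ferm" "q \<in> Q" "i \<in> {1..n}" "j \<in> {1..n}"
  shows "commute (E q j r s) (site k i)"
proof -
  have E: "E q j r s ** p x i = p x i ** E q j r s" if "x \<in> F" for x r s
    using mixed that assms unfolding qubits_commute_with_fermions_def by blast
  \<comment> \<open>Creation operators follow by taking adjoints of the relation for
    \<open>E q j s r\<close>.\<close>
  have "E q j r s ** dagger (p x i) = dagger (p x i) ** E q j r s" if "x \<in> F" for x
  proof -
    have "dagger (E q j s r) = E q j r s"
      using qubits assms unfolding qubit_system_def by blast
    then show ?thesis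
      using arg_cong[OF E[OF that, of s r], of dagger] by (simp add: dagger_mult)
  qed
  with E show ?thesis
    using assms(1) by (elim ferm_cases) (simp_all add: commute_iff operator_distribs)
qed

lemma pauli_commute_ferm:
  assumes "k \<in> ferm" "q \<in> Q" "i \<in> {1..n}" "j \<in> {1..n}"
  shows "commute (site (PX q) j) (site k i)" "commute (site (PZ q) j) (site k i)"
  using qubit_commute_ferm[OF assms]
  by (simp_all add: pauli_X_def pauli_Z_def commute_sym commute_linear)

lemma pauli_commute:
  assumes "q \<in> Q" "q' \<in> Q" "i \<in> {1..n}" "j \<in> {1..n}" "(q, i) \<noteq> (q', j)"
  shows "commute (site (PX q) i) (site (PZ q') j)" "commute (site (PZ q) i) (site (PZ q') j)"
proof -
  have "commute (E q i r s) (E q' j t u)" for r s t u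
    using qubits assms unfolding qubit_system_def commute_iff by blast
  then show "commute (site (PX q) i) (site (PZ q') j)" "commute (site (PZ q) i) (site (PZ q') j)"
    by (simp_all add: pauli_X_def pauli_Z_def commute_linear commute_sym)
qed

lemma pauli_same_site:
  assumes "q \<in> Q" "i \<in> {1..n}"
  shows "involution (site (PZ q) i)" "commute_up_to (-1) (site (PX q) i) (site (PZ q) i)"
    and "qubit_number E q i = minus_projection (site (PZ q) i)"
proof -
  \<comment> \<open>Writing \<open>mat 1\<close> as a sum of matrix units reduces all three claims
    to multiplication of matrix units.\<close>
  have E: "E q i r s ** E q i t u = (if s = t then E q i r u else 0)"
    "dagger (E q i r s) = E q i s r" "mat 1 = E q i False False + E q i True True" for r s t u
    using qubits assms unfolding qubit_system_def by metis+
  show "involution (site (PZ q) i)" "commute_up_to (-1) (site (PX q) i) (site (PZ q) i)"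
    by (simp_all add: involution_def commute_up_to_def pauli_X_def pauli_Z_def operator_distribs E)
  show "qubit_number E q i = minus_projection (site (PZ q) i)"
    by (simp add: minus_projection_def qubit_number_def pauli_Z_def E(3))
      (simp add: vec_eq_iff cscale_def)
qed

text \<open>A Majorana operator different from both factors anticommutes with each, and the two
  signs cancel; a Pauli operator commutes with each.\<close>

lemma parity_commute:
  assumes "k \<in> kinds F Q" "t \<in> ferm" "u \<in> ferm" "i \<in> {1..n}" "j \<in> {1..n}"
    and "(k, i) \<noteq> (t, j)" "(k, i) \<noteq> (u, j)"
  shows "commute (site k i) (par t u j)"
proof -
  have "commute (site k i) (site t j ** site u j)"
  proof (cases "k \<in> ferm")
    case True
    then show ?thesis
      using commute_up_to_mult_right[OF ferm_anticommute ferm_anticommute] assms by fastforce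
  next
    case False
    then obtain q where "q \<in> Q" "k = PX q \<or> k = PZ q"
      using assms(1) by (auto simp: kinds_def fermionic_kinds_def)
    then show ?thesis
      using pauli_commute_ferm assms by (blast intro: commute_mult)
  qed
  then show ?thesis unfolding parity_def by (rule commute_linear)
qed

text \<open>Each factor commutes with itself and anticommutes with the other, so exactly one sign
  remains.\<close>

lemma parity_flip:
  assumes "t \<in> ferm" "u \<in> ferm" "i \<in> {1..n}" "t \<noteq> u"
  shows "commute_up_to (-1) (site t i) (par t u i)" "commute_up_to (-1) (site u i) (par t u i)"
proof -
  have "commute_up_to (-1) (site t i) (site u i)" "commute_up_to (-1) (site u i) (site t i)"
    using ferm_anticommute assms by auto
  then have "commute_up_to (-1) (site t i) (site t i ** site u i)"
    "commute_up_to (-1) (site u i) (site t i ** site u i)"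
    using commute_up_to_mult_right[of 1 "site t i" "site t i" "-1" "site u i"]
      commute_up_to_mult_right[of "-1" "site u i" "site t i" 1 "site u i"] by auto
  then show "commute_up_to (-1) (site t i) (par t u i)" "commute_up_to (-1) (site u i) (par t u i)"
    by (simp_all add: parity_def commute_up_to_def operator_distribs)
qed

text \<open>The bare product of two anticommuting Hermitian square roots of \<open>1\<close> is
  anti-Hermitian and squares to \<open>-1\<close>; the prefactor \<open>- \<i>\<close> repairs
  both.\<close>

lemma parity_involution:
  assumes "t \<in> ferm" "u \<in> ferm" "i \<in> {1..n}" "t \<noteq> u"
  shows "involution (par t u i)"
proof -
  have tu: "site t i ** site u i = - (site u i ** site t i)"
    using ferm_anticommute[of t u i i] assms by (simp add: commute_up_to_def)
  have "(site t i ** site u i) ** (site u i ** site t i) = mat 1"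
    using ferm_square assms by (metis matrix_mul_assoc matrix_mul_lid)
  then have "(site t i ** site u i) ** (site t i ** site u i) = - mat 1"
    using tu by (metis matrix_mult_minus(2) minus_minus)
  moreover have "dagger (site t i ** site u i) = - (site t i ** site u i)"
    using tu assms by (simp add: dagger_mult ferm_hermitian)
  ultimately show ?thesis
    by (simp add: involution_def parity_def operator_distribs)
qed

text \<open>Because \<open>p\<close> and \<open>dagger p\<close> square to zero, the parity is
  \<open>p ** dagger p - dagger p ** p\<close>; subtracting it from the anticommutator
  \<open>mat 1\<close> leaves twice the number operator.\<close>

lemma number_eq_minus_projection:
  assumes "x \<in> F" "i \<in> {1..n}"
  shows "number p x i = minus_projection (par (MajT x) (Maj x) i)"
proof -
  have car: "p x i ** p x i + p x i ** p x i = 0"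
    "p x i ** dagger (p x i) + dagger (p x i) ** p x i = mat 1"
    using fermions assms unfolding fermion_system_def by auto
  have pp: "p x i ** p x i = 0"
    using car(1) by (simp add: vec_eq_iff)
  moreover have "dagger (p x i) ** dagger (p x i) = 0"
    using arg_cong[OF pp, of dagger] by (simp add: dagger_mult)
  ultimately have "par (MajT x) (Maj x) i = p x i ** dagger (p x i) - dagger (p x i) ** p x i"
    by (simp add: parity_def majorana_def majorana_tilde_def operator_distribs
        cscale.scale_right_diff_distrib)
  then have "mat 1 - par (MajT x) (Maj x) i = 2 *\<^sub>C number p x i"
    unfolding car(2)[symmetric] number_def by (simp add: vec_eq_iff cscale_def)
  then show ?thesis
    by (simp add: minus_projection_def)
qed

section \<open>Transversal conjugation and sorting of site products\<close>

lemma heisenberg_transversal: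
  assumes "k \<in> kinds F Q" "set w \<subseteq> kinds F Q" "S \<subseteq> {1..n}"
    and U: "\<And>i. i \<in> {1..n} \<Longrightarrow> unitary (U i)"
    and far: "\<And>l i j. l \<in> kinds F Q \<Longrightarrow> i \<in> {1..n} \<Longrightarrow> j \<in> {1..n} \<Longrightarrow> j \<noteq> i \<Longrightarrow>
      commute (site l i) (U j)"
    and near: "\<And>i. i \<in> {1..n} \<Longrightarrow> heisenberg (U i) (site k i) = c *\<^sub>C op_prod (\<lambda>t. site t i) w"
  shows "heisenberg (site_prod {1..n} U) (site_prod S (site k)) =
    c ^ card S *\<^sub>C site_prod S (\<lambda>i. op_prod (\<lambda>t. site t i) w)"
proof -
  have fin: "finite S" using assms(3) finite_subset by blast
  \<comment> \<open>The image is again a word in operators of site \<open>i\<close>, so gates on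
    other sites still commute with it.\<close>
  have "commute (heisenberg (U i) (site k i)) (U j)" if ij: "i \<in> {1..n}" "j \<in> {1..n}" "j \<noteq> i" for i j
  proof -
    have "commute (U j) (op_prod (\<lambda>t. site t i) w)"
      by (rule commute_op_prod) (use far[OF _ ij] assms(2) commute_sym in blast)
    then show ?thesis
      unfolding near[OF ij(1)] by (intro commute_sym[OF commute_linear(3)])
  qed
  then have "heisenberg (site_prod {1..n} U) (site_prod S (site k)) =
      site_prod S (\<lambda>i. heisenberg (U i) (site k i))"
    using assms(1,3) U far by (intro heisenberg_site_prod) auto
  also have "\<dots> = site_prod S (\<lambda>i. c *\<^sub>C op_prod (\<lambda>t. site t i) w)"
    unfolding site_prod_eq_op_prod
    by (rule op_prod_cong) (use fin assms(3) near in auto)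
  finally show ?thesis
    by (simp add: site_prod_eq_op_prod op_prod_cscale)
qed

lemma site_prod_pair:
  assumes "S \<subseteq> {1..n}" "\<And>i j. i \<in> {1..n} \<Longrightarrow> j \<in> {1..n} \<Longrightarrow> i \<noteq> j \<Longrightarrow> commute_up_to s (B i) (A j)"
  shows "site_prod S (\<lambda>i. A i ** B i) =
    s ^ (card S * (card S - 1) div 2) *\<^sub>C (site_prod S A ** site_prod S B)"
proof -
  have "finite S" using assms(1) finite_subset by blast
  then show ?thesis
    using op_prod_interleave[of "sorted_list_of_set S" s B A] assms
    by (simp add: site_prod_eq_op_prod subset_iff)
qed

lemma site_prod_fermion_pair:
  assumes "S \<subseteq> {1..n}" "t \<in> ferm" "u \<in> ferm"
  shows "site_prod S (\<lambda>i. site t i ** site u i) =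
    (-1) ^ (card S * (card S - 1) div 2) *\<^sub>C (site_prod S (site t) ** site_prod S (site u))"
  by (rule site_prod_pair) (use assms ferm_anticommute in auto)

section \<open>Transversal gates\<close>

text \<open>The site operators of kind \<open>k\<close> become \<open>\<alpha>\<close> times a word \<open>w\<close> of site operators, and sorting
  the product over \<open>m\<close> sites by kinds costs a scalar, \<open>c m\<close> in total.  It must be \<open>1\<close> on
  plaquettes, but may be a sign or phase for the odd number \<open>n\<close> of sites.\<close>

definition transversal_image ::
    "(nat \<Rightarrow> 'h operator) \<Rightarrow> ('f, 'q) kind \<Rightarrow> 'h operator \<Rightarrow> bool" where
  "transversal_image U k L \<longleftrightarrow> (\<exists>w \<alpha> c. distinct w \<and> set w \<subseteq> kinds F Q \<and> c 4 = 1 \<and> c 6 = 1 \<and>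
     (\<forall>i\<in>{1..n}. heisenberg (U i) (site k i) = \<alpha> *\<^sub>C op_prod (\<lambda>t. site t i) w) \<and>
     (\<forall>S\<subseteq>{1..n}. \<alpha> ^ card S *\<^sub>C site_prod S (\<lambda>i. op_prod (\<lambda>t. site t i) w) =
       c (card S) *\<^sub>C op_prod (\<lambda>t. site_prod S (site t)) w) \<and>
     L = c n *\<^sub>C op_prod logic w)"

lemma transversal_imageI:
  assumes "distinct w" "set w \<subseteq> kinds F Q" "c 4 = 1" "c 6 = 1"
    and "\<And>i. i \<in> {1..n} \<Longrightarrow> heisenberg (U i) (site k i) = \<alpha> *\<^sub>C op_prod (\<lambda>t. site t i) w"
    and "\<And>S. S \<subseteq> {1..n} \<Longrightarrow> \<alpha> ^ card S *\<^sub>C site_prod S (\<lambda>i. op_prod (\<lambda>t. site t i) w) =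
       c (card S) *\<^sub>C op_prod (\<lambda>t. site_prod S (site t)) w"
    and "L = c n *\<^sub>C op_prod logic w"
  shows "transversal_image U k L"
  unfolding transversal_image_def using assms
  by (intro exI[of _ w] exI[of _ \<alpha>] exI[of _ c] conjI allI ballI impI)

lemma transversal_gateI:
  assumes Ps: "\<And>S. S \<in> Ps \<Longrightarrow> S \<subseteq> {1..n} \<and> card S \<in> {4, 6}"
    and U: "\<And>i. i \<in> {1..n} \<Longrightarrow> unitary (U i)"
    and far: "\<And>l i j. l \<in> kinds F Q \<Longrightarrow> i \<in> {1..n} \<Longrightarrow> j \<in> {1..n} \<Longrightarrow> j \<noteq> i \<Longrightarrow>
      commute (site l i) (U j)"
    and im: "\<And>k. k \<in> kinds F Q \<Longrightarrow> transversal_image U k (L' k)"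
  shows "logical_gate Ps n F Q p E (site_prod {1..n} U) L'"
proof (rule logical_gateI[OF Ps])
  fix k :: "('f, 'q) kind" assume k: "k \<in> kinds F Q"
  from im[OF k] obtain w \<alpha> c where w: "distinct w" "set w \<subseteq> kinds F Q" and c: "c 4 = 1" "c 6 = 1"
    and near: "\<forall>i\<in>{1..n}. heisenberg (U i) (site k i) = \<alpha> *\<^sub>C op_prod (\<lambda>t. site t i) w"
    and collect: "\<forall>S\<subseteq>{1..n}. \<alpha> ^ card S *\<^sub>C site_prod S (\<lambda>i. op_prod (\<lambda>t. site t i) w) =
       c (card S) *\<^sub>C op_prod (\<lambda>t. site_prod S (site t)) w"
    and L: "L' k = c n *\<^sub>C op_prod logic w"
    unfolding transversal_image_def by (elim exE conjE) (rule that)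
  have "heisenberg (site_prod {1..n} U) (site_prod S (site k)) =
      c (card S) *\<^sub>C op_prod (\<lambda>t. site_prod S (site t)) w" if "S \<subseteq> {1..n}" for S
  proof -
    have "heisenberg (site_prod {1..n} U) (site_prod S (site k)) =
        \<alpha> ^ card S *\<^sub>C site_prod S (\<lambda>i. op_prod (\<lambda>t. site t i) w)"
      by (rule heisenberg_transversal[OF k w(2) that U far bspec[OF near]])
    also have "\<dots> = c (card S) *\<^sub>C op_prod (\<lambda>t. site_prod S (site t)) w"
      using collect that by (elim allE impE)
    finally show ?thesis .
  qed
  then show "\<exists>w c. distinct w \<and> set w \<subseteq> kinds F Q \<and> c 4 = 1 \<and> c 6 = 1 \<and>
      (\<forall>S\<subseteq>{1..n}. heisenberg (site_prod {1..n} U) (site_prod S (site k)) =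
        c (card S) *\<^sub>C op_prod (\<lambda>t. site_prod S (site t)) w) \<and>
      L' k = c n *\<^sub>C op_prod logic w"
    using w c L by (intro exI[of _ w] exI[of _ c] conjI allI impI)
qed

lemma transversal_image_eq:
  assumes "w \<in> kinds F Q" "\<And>i. i \<in> {1..n} \<Longrightarrow> heisenberg (U i) (site k i) = site w i"
  shows "transversal_image U k (logic w)"
  by (rule transversal_imageI[where w = "[w]" and \<alpha> = 1 and c = "\<lambda>_. 1"]) (use assms in auto)

text \<open>The sign \<open>(-1) ^ m\<close> disappears on four or six sites and survives on the odd
  number \<open>n\<close>.\<close>

lemma transversal_image_minus:
  assumes "w \<in> kinds F Q" "odd n" "\<And>i. i \<in> {1..n} \<Longrightarrow> heisenberg (U i) (site k i) = - site w i"
  shows "transversal_image U k (- logic w)"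
  by (rule transversal_imageI[where w = "[w]" and \<alpha> = "-1" and c = "\<lambda>m. (-1) ^ m"])
    (use assms in auto)

text \<open>Covers both \<open>BRAID\<close> and \<open>S_f\<close>: only the relative phase
  \<open>cnj c1 * c2 = - \<i>\<close> matters. Conjugation multiplies an operator that anticommutes
  with the parity by \<open>site t i ** site u i\<close>, which sends \<open>t\<close> to
  \<open>- u\<close> and \<open>u\<close> to \<open>t\<close>.\<close>

lemma quarter_turn_gate:
  assumes t: "t \<in> ferm" and u: "u \<in> ferm" and tu: "t \<noteq> u" and "odd n"
    and Ps: "\<And>S. S \<in> Ps \<Longrightarrow> S \<subseteq> {1..n} \<and> card S \<in> {4, 6}"
    and c: "cnj c1 * c1 = 1" "cnj c2 * c2 = 1" "cnj c1 * c2 = - \<i>"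
  shows "logical_gate Ps n F Q p E
    (site_prod {1..n} (\<lambda>i. spectral c1 c2 (minus_projection (par t u i))))
    (logic (t := - logic u, u := logic t))"
    (is "logical_gate _ _ _ _ _ _ (site_prod _ ?U) _")
proof -
  have c': "cnj c2 * c1 = \<i>"
    using arg_cong[OF c(3), of cnj] by (simp add: mult.commute)
  have proj: "orthogonal_projection (minus_projection (par t u i))" if "i \<in> {1..n}" for i
    using parity_involution[OF t u that tu] by (rule orthogonal_projection_minus)
  then have un: "unitary (?U i)" if "i \<in> {1..n}" for i
    using that c by (intro unitary_spectral) auto
  have inv: "commute (site l i) (?U j)"
    if "l \<in> kinds F Q" "i \<in> {1..n}" "j \<in> {1..n}" "j \<noteq> i \<or> l \<notin> {t, u}" for l i j
    using that parity_commute[OF that(1) t u that(2,3)]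
    by (intro commute_spectral commute_minus_projection) auto
  have flip: "heisenberg (?U i) A = site t i ** site u i ** A"
    if "i \<in> {1..n}" "commute_up_to (-1) A (par t u i)" for i A
  proof -
    have "heisenberg (?U i) A = spectral (- \<i>) \<i> (minus_projection (par t u i)) ** A"
      using heisenberg_spectral_flip[OF proj[OF that(1)] minus_projection_flip[OF that(2)]]
      by (simp add: c(3) c')
    \<comment> \<open>The coefficients are \<open>\<i>\<close> times the eigenvalues
      \<open>-1\<close> and \<open>1\<close> of the parity; the \<open>\<i>\<close> then cancels the
      prefactor in \<open>parity\<close>.\<close>
    also have "spectral (- \<i>) \<i> (minus_projection (par t u i)) = \<i> *\<^sub>C par t u i"
      by (simp add: spectral_def minus_projection_def)
        (simp add: vec_eq_iff cscale_def field_simps)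
    finally show ?thesis by (simp add: parity_def)
  qed
  show ?thesis
  proof (rule transversal_gateI[OF Ps un inv])
    fix k :: "('f, 'q) kind" assume k: "k \<in> kinds F Q"
    consider "k = t" | "k = u" | "k \<notin> {t, u}" by blast
    then show "transversal_image ?U k ((logic (t := - logic u, u := logic t)) k)"
    proof cases
      case 1
      have "site t i ** site u i ** site t i = - site u i" if "i \<in> {1..n}" for i
        using ferm_anticommute[OF t u that that] ferm_square[OF t that] tu
        by (simp add: commute_up_to_def operator_distribs flip: matrix_mul_assoc)
      then have "transversal_image ?U t (- logic u)"
        using flip parity_flip(1)[OF t u _ tu] ferm_in_kinds[OF u] \<open>odd n\<close>
        by (intro transversal_image_minus) simp_all
      then show ?thesis using 1 tu by simp
    next
      case 2
      have "site t i ** site u i ** site u i = site t i" if "i \<in> {1..n}" for i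
        using ferm_square[OF u that] by (simp flip: matrix_mul_assoc)
      then have "transversal_image ?U u (logic t)"
        using flip parity_flip(2)[OF t u _ tu] ferm_in_kinds[OF t]
        by (intro transversal_image_eq) simp_all
      then show ?thesis using 2 by simp
    next
      case 3
      then have "transversal_image ?U k (logic k)"
        using heisenberg_commute[OF un] inv k by (intro transversal_image_eq) auto
      then show ?thesis using 3 by simp
    qed
  qed auto
qed

lemma BRAID_eq_spectral:
  assumes "a \<in> F" "b \<in> F" "i \<in> {1..n}"
  shows "BRAID p a i b i = spectral (exp (\<i> * of_real (pi / 4))) (exp (- \<i> * of_real (pi / 4)))
    (minus_projection (par (MajT a) (Maj b) i))"
proof -
  have inv: "involution (par (MajT a) (Maj b) i)"
    using assms by (intro parity_involution) (auto simp: fermionic_kinds_def)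
  \<comment> \<open>The bilinear equals \<open>\<i>\<close> times the parity, so its eigenvalue on
    the \<open>-1\<close> eigenspace is \<open>- \<i>\<close>, and the exponent there is
    \<open>\<i> * pi / 4\<close>.\<close>
  have "(- (pi / 4)) *\<^sub>R (majorana_tilde p a i ** majorana p b i) =
      spectral (\<i> * of_real (pi / 4)) (- \<i> * of_real (pi / 4))
        (minus_projection (par (MajT a) (Maj b) i))"
    unfolding scaleR_cscale
    by (simp add: spectral_def minus_projection_def parity_def)
      (simp add: vec_eq_iff cscale_def field_simps)
  then show ?thesis
    using orthogonal_projection_minus[OF inv]
    by (simp add: BRAID_def mexp_spectral orthogonal_projection_def)
qed

lemma S_f_eq_spectral:
  assumes "a \<in> F" "i \<in> {1..n}"
  shows "S_f p a i = spectral \<i> 1 (minus_projection (par (MajT a) (Maj a) i))"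
proof -
  have inv: "involution (par (MajT a) (Maj a) i)"
    using assms by (intro parity_involution) (auto simp: fermionic_kinds_def)
  have "exp (\<i> * of_real (pi / 2)) = \<i>"
    using cis_pi_half by (simp add: cis_conv_exp)
  then show ?thesis
    using mexp_cscale_projection[OF orthogonal_projection_minus[OF inv]] assms
    by (simp add: S_f_def number_eq_minus_projection)
qed

lemma BRAID_gate:
  assumes "a \<in> F" "b \<in> F" "odd n" and Ps: "\<And>S. S \<in> Ps \<Longrightarrow> S \<subseteq> {1..n} \<and> card S \<in> {4, 6}"
  shows "logical_gate Ps n F Q p E (site_prod {1..n} (\<lambda>i. BRAID p a i b i))
    (logic (MajT a := - logic (Maj b), Maj b := logic (MajT a)))"
proof -
  let ?c = "exp (\<i> * of_real (pi / 4)) :: complex" and ?c' = "exp (- \<i> * of_real (pi / 4)) :: complex"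
  have c: "cnj ?c * ?c = 1" "cnj ?c' * ?c' = 1"
    by (simp_all add: exp_cnj flip: exp_add)
  \<comment> \<open>The relative phase is a quarter turn: two angles of \<open>pi / 4\<close> add
    up.\<close>
  have "cnj ?c * ?c' = exp (- (\<i> * of_real (pi / 2)))"
    by (simp add: exp_cnj flip: exp_add)
  also have "\<dots> = - \<i>"
    using cis_pi_half by (simp add: exp_minus cis_conv_exp)
  finally show ?thesis
    using quarter_turn_gate[OF _ _ _ \<open>odd n\<close> Ps c, of "MajT a" "Maj b"] assms(1,2)
    by (subst site_prod_cong[OF _ BRAID_eq_spectral]) (auto simp: fermionic_kinds_def)
qed

lemma S_f_gate:
  assumes "a \<in> F" "odd n" and Ps: "\<And>S. S \<in> Ps \<Longrightarrow> S \<subseteq> {1..n} \<and> card S \<in> {4, 6}"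
  shows "logical_gate Ps n F Q p E (site_prod {1..n} (\<lambda>i. S_f p a i))
    (logic (Maj a := logic (MajT a), MajT a := - logic (Maj a)))"
  using quarter_turn_gate[OF _ _ _ \<open>odd n\<close> Ps, of "MajT a" "Maj a" Ps \<i> 1] assms(1)
  by (subst site_prod_cong[OF _ S_f_eq_spectral], simp_all)
    \<comment> \<open>Swaps the two updates, which \<open>quarter_turn_gate\<close> lists in the
      opposite order.\<close>
    (subst fun_upd_twist, simp_all add: fermionic_kinds_def)

section \<open>Controlled gates\<close>

text \<open>The pair \<open>t\<close>, \<open>u\<close> commutes with \<open>k\<close> on every
  site, the same one included. Only the sorting inside the pairs costs a sign, whichever side
  \<open>k\<close> stands on.\<close>

lemma site_prod_three:
  assumes S: "S \<subseteq> {1..n}" and t: "t \<in> ferm" and u: "u \<in> ferm" and k: "k \<in> kinds F Q" "k \<notin> {t, u}"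
  shows "site_prod S (\<lambda>i. op_prod (\<lambda>l. site l i) [k, t, u]) =
      (-1) ^ (card S * (card S - 1) div 2) *\<^sub>C op_prod (\<lambda>l. site_prod S (site l)) [k, t, u]"
    and "site_prod S (\<lambda>i. op_prod (\<lambda>l. site l i) [t, u, k]) =
      (-1) ^ (card S * (card S - 1) div 2) *\<^sub>C op_prod (\<lambda>l. site_prod S (site l)) [t, u, k]"
proof -
  have cm: "commute (site k i) (site t j ** site u j)" if "i \<in> {1..n}" "j \<in> {1..n}" for i j
  proof -
    \<comment> \<open>The factor \<open>\<i>\<close> undoes the \<open>- \<i>\<close> in
      \<open>parity\<close> and exposes the bare bilinear.\<close>
    have "commute (site k i) (\<i> *\<^sub>C par t u j)"
      using that k by (intro commute_linear(3) parity_commute t u) auto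
    then show ?thesis by (simp add: parity_def)
  qed
  have "site_prod S (\<lambda>i. site k i ** (site t i ** site u i)) =
      site_prod S (site k) ** site_prod S (\<lambda>i. site t i ** site u i)"
    using site_prod_pair[OF S, of 1 "\<lambda>i. site t i ** site u i" "site k"] cm by (simp add: commute_sym)
  then show "site_prod S (\<lambda>i. op_prod (\<lambda>l. site l i) [k, t, u]) =
      (-1) ^ (card S * (card S - 1) div 2) *\<^sub>C op_prod (\<lambda>l. site_prod S (site l)) [k, t, u]"
    using site_prod_fermion_pair[OF S t u] by (simp add: cscale_mult_right)
  have "site_prod S (\<lambda>i. (site t i ** site u i) ** site k i) =
      site_prod S (\<lambda>i. site t i ** site u i) ** site_prod S (site k)"
    using site_prod_pair[OF S, of 1 "site k" "\<lambda>i. site t i ** site u i"] cm by simp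
  then show "site_prod S (\<lambda>i. op_prod (\<lambda>l. site l i) [t, u, k]) =
      (-1) ^ (card S * (card S - 1) div 2) *\<^sub>C op_prod (\<lambda>l. site_prod S (site l)) [t, u, k]"
    using site_prod_fermion_pair[OF S t u] by (simp add: cscale_mult_left matrix_mul_assoc)
qed

text \<open>For odd \<open>n\<close> the prefactor of the logical Z is exactly the phase gained by
  collecting \<open>n\<close> site parities.\<close>

lemma logical_ferm_Z_eq:
  "odd n \<Longrightarrow> logical_ferm_Z n p E b = pairing_phase n *\<^sub>C (logic (MajT b) ** logic (Maj b))"
  by (simp add: logical_ferm_Z_def pairing_phase_odd)

text \<open>Each site contributes \<open>- \<i>\<close>, and sorting the Majorana pairs contributes
  the crossing sign; together they form \<open>pairing_phase\<close>. The order with Z on the left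
  is the one for the qubit X.\<close>

lemma transversal_image_ferm_Z_left:
  assumes b: "b \<in> F" and k: "k \<in> kinds F Q" "k \<notin> {MajT b, Maj b}" and "odd n"
    and U: "\<And>i. i \<in> {1..n} \<Longrightarrow> heisenberg (U i) (site k i) = par (MajT b) (Maj b) i ** site k i"
  shows "transversal_image U k (logical_ferm_Z n p E b ** logic k)"
proof (rule transversal_imageI[where w = "[MajT b, Maj b, k]" and \<alpha> = "- \<i>" and c = pairing_phase])
  have ferm: "MajT b \<in> ferm" "Maj b \<in> ferm"
    using b by (auto simp: fermionic_kinds_def)
  then show "set [MajT b, Maj b, k] \<subseteq> kinds F Q"
    using k ferm_in_kinds by auto
  show "distinct [MajT b, Maj b, k]"
    using k by auto
  show "heisenberg (U i) (site k i) = (- \<i>) *\<^sub>C op_prod (\<lambda>t. site t i) [MajT b, Maj b, k]"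
    if "i \<in> {1..n}" for i
    using U[OF that] by (simp add: parity_def operator_distribs matrix_mul_assoc)
  show "(- \<i>) ^ card S *\<^sub>C site_prod S (\<lambda>i. op_prod (\<lambda>t. site t i) [MajT b, Maj b, k]) =
      pairing_phase (card S) *\<^sub>C op_prod (\<lambda>t. site_prod S (site t)) [MajT b, Maj b, k]"
    if "S \<subseteq> {1..n}" for S
    unfolding site_prod_three(2)[OF that ferm k] by (simp add: pairing_phase_def)
  show "logical_ferm_Z n p E b ** logic k = pairing_phase n *\<^sub>C op_prod logic [MajT b, Maj b, k]"
    by (simp add: logical_ferm_Z_eq[OF \<open>odd n\<close>] cscale_mult_left matrix_mul_assoc)
qed (fact pairing_phase_4_6)+

lemma transversal_image_ferm_Z_right:
  assumes b: "b \<in> F" and k: "k \<in> kinds F Q" "k \<notin> {MajT b, Maj b}" and "odd n"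
    and U: "\<And>i. i \<in> {1..n} \<Longrightarrow> heisenberg (U i) (site k i) = par (MajT b) (Maj b) i ** site k i"
  shows "transversal_image U k (logic k ** logical_ferm_Z n p E b)"
proof (rule transversal_imageI[where w = "[k, MajT b, Maj b]" and \<alpha> = "- \<i>" and c = pairing_phase])
  have ferm: "MajT b \<in> ferm" "Maj b \<in> ferm"
    using b by (auto simp: fermionic_kinds_def)
  then show "set [k, MajT b, Maj b] \<subseteq> kinds F Q"
    using k ferm_in_kinds by auto
  show "distinct [k, MajT b, Maj b]"
    using k by auto
  show "heisenberg (U i) (site k i) = (- \<i>) *\<^sub>C op_prod (\<lambda>t. site t i) [k, MajT b, Maj b]"
    if "i \<in> {1..n}" for i
  proof -
    \<comment> \<open>The local parity may be moved to the right, giving the order needed for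
      fermionic \<open>k\<close>.\<close>
    have "commute (site k i) (par (MajT b) (Maj b) i)"
      using k that by (intro parity_commute ferm) auto
    then have "heisenberg (U i) (site k i) = site k i ** par (MajT b) (Maj b) i"
      using U[OF that] by (simp only: commute_iff)
    then show ?thesis
      by (simp add: parity_def operator_distribs)
  qed
  show "(- \<i>) ^ card S *\<^sub>C site_prod S (\<lambda>i. op_prod (\<lambda>t. site t i) [k, MajT b, Maj b]) =
      pairing_phase (card S) *\<^sub>C op_prod (\<lambda>t. site_prod S (site t)) [k, MajT b, Maj b]"
    if "S \<subseteq> {1..n}" for S
    unfolding site_prod_three(1)[OF that ferm k] by (simp add: pairing_phase_def)
  show "logic k ** logical_ferm_Z n p E b = pairing_phase n *\<^sub>C op_prod logic [k, MajT b, Maj b]"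
    by (simp add: logical_ferm_Z_eq[OF \<open>odd n\<close>] cscale_mult_right)
qed (fact pairing_phase_4_6)+

text \<open>Qubit and fermionic operators commute, so sorting is free and the scalar is
  \<open>1\<close> for every number of sites.\<close>

lemma transversal_image_pauli_Z:
  assumes q: "q \<in> Q" and k: "k \<in> ferm"
    and U: "\<And>i. i \<in> {1..n} \<Longrightarrow> heisenberg (U i) (site k i) = site (PZ q) i ** site k i"
  shows "transversal_image U k (logic (PZ q) ** logic k)"
proof (rule transversal_imageI[where w = "[PZ q, k]" and \<alpha> = 1 and c = "\<lambda>_. 1"])
  show "set [PZ q, k] \<subseteq> kinds F Q" "distinct [PZ q, k]"
    using q k by (auto simp: kinds_def fermionic_kinds_def)
  show "1 ^ card S *\<^sub>C site_prod S (\<lambda>i. op_prod (\<lambda>t. site t i) [PZ q, k]) =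
      1 *\<^sub>C op_prod (\<lambda>t. site_prod S (site t)) [PZ q, k]" if "S \<subseteq> {1..n}" for S
    using site_prod_pair[OF that, of 1 "site k" "site (PZ q)"]
      commute_sym[OF pauli_commute_ferm(2)[OF k q]] by simp
qed (use U in simp_all)

lemma CZ_f_eq_controlled_sign:
  assumes "a \<in> F" "b \<in> F" "a \<noteq> b" "i \<in> {1..n}"
  shows "CZ_f p a i b i = controlled_sign (par (MajT a) (Maj a) i) (par (MajT b) (Maj b) i)"
    and "involution (par (MajT a) (Maj a) i)"
    and "commute (par (MajT a) (Maj a) i) (par (MajT b) (Maj b) i)"
proof -
  have ferm: "MajT x \<in> ferm" "Maj x \<in> ferm" if "x \<in> F" for x
    using that by (auto simp: fermionic_kinds_def)
  show inv: "involution (par (MajT a) (Maj a) i)"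
    using assms ferm by (intro parity_involution) auto
  have inv': "involution (par (MajT b) (Maj b) i)"
    using assms ferm by (intro parity_involution) auto
  have "commute (site k i) (par (MajT b) (Maj b) i)" if "k \<in> {MajT a, Maj a}" for k
    using that assms ferm by (intro parity_commute ferm_in_kinds) auto
  then have "commute (site (MajT a) i ** site (Maj a) i) (par (MajT b) (Maj b) i)"
    by (intro commute_mult(2)) blast+
  then show cm: "commute (par (MajT a) (Maj a) i) (par (MajT b) (Maj b) i)"
    unfolding parity_def[of p E "MajT a"] by (rule commute_sym[OF commute_linear(3)[OF commute_sym]])
  show "CZ_f p a i b i = controlled_sign (par (MajT a) (Maj a) i) (par (MajT b) (Maj b) i)"
    using mexp_controlled_sign[OF inv inv' cm] assms
    by (simp add: CZ_f_def number_eq_minus_projection)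
qed

lemma CZ_f_gate:
  assumes a: "a \<in> F" and b: "b \<in> F" and ab: "a \<noteq> b" and "odd n"
    and Ps: "\<And>S. S \<in> Ps \<Longrightarrow> S \<subseteq> {1..n} \<and> card S \<in> {4, 6}"
  shows "logical_gate Ps n F Q p E (site_prod {1..n} (\<lambda>i. CZ_f p a i b i))
    (logic (Maj a := logic (Maj a) ** logical_ferm_Z n p E b,
            MajT a := logic (MajT a) ** logical_ferm_Z n p E b,
            Maj b := logic (Maj b) ** logical_ferm_Z n p E a,
            MajT b := logic (MajT b) ** logical_ferm_Z n p E a))"
    (is "logical_gate _ _ _ _ _ _ (site_prod _ ?U) ?L")
proof -
  let ?Z = "\<lambda>x. par (MajT x) (Maj x)"
  have ferm: "MajT x \<in> ferm" "Maj x \<in> ferm" if "x \<in> F" for x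
    using that by (auto simp: fermionic_kinds_def)
  note CZ = CZ_f_eq_controlled_sign[OF a b ab]
  note inv = CZ(2) CZ_f_eq_controlled_sign(2)[OF b a ab[symmetric]]
  have un: "unitary (?U i)" if "i \<in> {1..n}" for i
    using CZ(1,3)[OF that] inv that by (simp add: unitary_controlled_sign)
  have far: "commute (site l i) (?U j)" if "l \<in> kinds F Q" "i \<in> {1..n}" "j \<in> {1..n}"
    "j \<noteq> i \<or> l \<notin> {Maj a, MajT a, Maj b, MajT b}" for l i j
    using that ferm a b unfolding CZ(1)[OF that(3)]
    by (intro commute_controlled_sign parity_commute) auto
  \<comment> \<open>Stated for general \<open>x\<close> and \<open>y\<close>, since either block may
    play the control; \<open>sym\<close> supplies the exchanged form of the gate.\<close>
  have flip: "heisenberg (controlled_sign (?Z x i) (?Z y i)) (site k i) = ?Z y i ** site k i"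
    if "i \<in> {1..n}" "k \<in> {Maj x, MajT x}" "x \<in> F" "y \<in> F" "x \<noteq> y" for i k x y
  proof (rule heisenberg_controlled_sign)
    show "commute_up_to (-1) (site k i) (?Z x i)"
      using that parity_flip[of "MajT x" "Maj x" i] ferm by auto
    show "commute (site k i) (?Z y i)"
      using that ferm by (intro parity_commute ferm_in_kinds) auto
    show "involution (?Z x i)" "involution (?Z y i)" "commute (?Z x i) (?Z y i)"
      using CZ_f_eq_controlled_sign(2,3)[of x y i] CZ_f_eq_controlled_sign(2)[of y x i] that by auto
  qed
  have sym: "?U i = controlled_sign (?Z b i) (?Z a i)" if "i \<in> {1..n}" for i
    unfolding CZ(1)[OF that] by (rule controlled_sign_commute[OF CZ(3)[OF that]])
  show ?thesis
  proof (rule transversal_gateI[OF Ps un far])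
    fix k :: "('f, 'q) kind" assume k: "k \<in> kinds F Q"
    consider "k \<in> {Maj a, MajT a}" | "k \<in> {Maj b, MajT b}" | "k \<notin> {Maj a, MajT a, Maj b, MajT b}"
      by blast
    then show "transversal_image ?U k (?L k)"
    proof cases
      case 1
      then have "transversal_image ?U k (logic k ** logical_ferm_Z n p E b)"
        using b k ab \<open>odd n\<close> flip[OF _ 1 a b ab] CZ(1)
        by (intro transversal_image_ferm_Z_right) auto
      then show ?thesis using 1 ab by auto
    next
      case 2
      then have "transversal_image ?U k (logic k ** logical_ferm_Z n p E a)"
        using a k ab \<open>odd n\<close> flip[OF _ 2 b a ab[symmetric]] sym
        by (intro transversal_image_ferm_Z_right) auto
      then show ?thesis using 2 by auto
    next
      case 3
      then have "transversal_image ?U k (logic k)"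
        using heisenberg_commute[OF un] far k by (intro transversal_image_eq) auto
      then show ?thesis using 3 by auto
    qed
  qed auto
qed

lemma CZ_qf_eq_controlled_sign:
  assumes "q \<in> Q" "b \<in> F" "i \<in> {1..n}"
  shows "CZ_qf p E q i b i = controlled_sign (site (PZ q) i) (par (MajT b) (Maj b) i)"
    and "involution (par (MajT b) (Maj b) i)"
    and "commute (site (PZ q) i) (par (MajT b) (Maj b) i)"
proof -
  have ferm: "MajT b \<in> ferm" "Maj b \<in> ferm"
    using assms by (auto simp: fermionic_kinds_def)
  show inv: "involution (par (MajT b) (Maj b) i)"
    using assms ferm by (intro parity_involution) auto
  show cm: "commute (site (PZ q) i) (par (MajT b) (Maj b) i)"
    using assms ferm by (intro parity_commute) (auto simp: kinds_def)
  show "CZ_qf p E q i b i = controlled_sign (site (PZ q) i) (par (MajT b) (Maj b) i)"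
    using mexp_controlled_sign[OF pauli_same_site(1) inv cm] pauli_same_site(3) assms
    by (simp only: CZ_qf_def number_eq_minus_projection)
qed

lemma CZ_qf_gate:
  assumes q: "q \<in> Q" and b: "b \<in> F" and "odd n"
    and Ps: "\<And>S. S \<in> Ps \<Longrightarrow> S \<subseteq> {1..n} \<and> card S \<in> {4, 6}"
  shows "logical_gate Ps n F Q p E (site_prod {1..n} (\<lambda>i. CZ_qf p E q i b i))
    (logic (Maj b := logic (PZ q) ** logic (Maj b),
            MajT b := logic (PZ q) ** logic (MajT b),
            PX q := logical_ferm_Z n p E b ** logic (PX q)))"
    (is "logical_gate _ _ _ _ _ _ (site_prod _ ?U) ?L")
proof -
  let ?Z = "par (MajT b) (Maj b)"
  have ferm: "MajT b \<in> ferm" "Maj b \<in> ferm"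
    using b by (auto simp: fermionic_kinds_def)
  note CZ = CZ_qf_eq_controlled_sign[OF q b]
  have un: "unitary (?U i)" if "i \<in> {1..n}" for i
    using CZ[OF that] pauli_same_site(1)[OF q that] by (simp add: unitary_controlled_sign)
  \<comment> \<open>The one excluded case is \<open>PX q\<close> on the same site, which
    anticommutes.\<close>
  have pauli: "commute (site l i) (site (PZ q) j)"
    if l: "l \<in> kinds F Q" "i \<in> {1..n}" "j \<in> {1..n}" "j \<noteq> i \<or> l \<noteq> PX q" for l i j
  proof (cases "l \<in> ferm")
    case True
    then show ?thesis using commute_sym[OF pauli_commute_ferm(2)[OF True q l(2,3)]] by simp
  next
    case False
    then obtain q' where q': "q' \<in> Q" "l = PX q' \<or> l = PZ q'"
      using l(1) by (auto simp: kinds_def fermionic_kinds_def)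
    show ?thesis
    proof (cases "(q', i) = (q, j)")
      case True
      then show ?thesis using q' l(4) by auto
    next
      case False
      then show ?thesis using pauli_commute[OF q'(1) q l(2,3)] q'(2) by blast
    qed
  qed
  have far: "commute (site l i) (?U j)" if "l \<in> kinds F Q" "i \<in> {1..n}" "j \<in> {1..n}"
    "j \<noteq> i \<or> l \<notin> {Maj b, MajT b, PX q}" for l i j
    using that ferm pauli unfolding CZ(1)[OF that(3)]
    by (intro commute_controlled_sign parity_commute) auto
  have flipX: "heisenberg (?U i) (site (PX q) i) = ?Z i ** site (PX q) i" if "i \<in> {1..n}" for i
    unfolding CZ(1)[OF that]
  proof (rule heisenberg_controlled_sign)
    show "commute (site (PX q) i) (?Z i)"
      using that q ferm by (intro parity_commute) (auto simp: kinds_def)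
  qed (use pauli_same_site[OF q that] CZ(2,3)[OF that] in auto)
  have flipF: "heisenberg (?U i) (site k i) = site (PZ q) i ** site k i"
    if "i \<in> {1..n}" "k \<in> {Maj b, MajT b}" for i k
    \<comment> \<open>Control and target are exchanged, because a Majorana operator flips the
      fermion parity and leaves the qubit Z alone.\<close>
    unfolding CZ(1)[OF that(1)] controlled_sign_commute[OF CZ(3)[OF that(1)]]
  proof (rule heisenberg_controlled_sign)
    show "commute_up_to (-1) (site k i) (?Z i)"
      using that parity_flip[of "MajT b" "Maj b" i] ferm by auto
    show "commute (site k i) (site (PZ q) i)"
      using that ferm by (intro pauli ferm_in_kinds) auto
    show "involution (?Z i)" "involution (site (PZ q) i)" "commute (?Z i) (site (PZ q) i)"
      using CZ(2,3)[OF that(1)] pauli_same_site(1)[OF q that(1)] commute_sym by auto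
  qed
  show ?thesis
  proof (rule transversal_gateI[OF Ps un far])
    fix k :: "('f, 'q) kind" assume k: "k \<in> kinds F Q"
    consider "k \<in> {Maj b, MajT b}" | "k = PX q" | "k \<notin> {Maj b, MajT b, PX q}"
      by blast
    then show "transversal_image ?U k (?L k)"
    proof cases
      case 1
      then have "transversal_image ?U k (logic (PZ q) ** logic k)"
        using flipF[OF _ 1] ferm by (intro transversal_image_pauli_Z q) auto
      then show ?thesis using 1 by auto
    next
      case 2
      then have "transversal_image ?U k (logical_ferm_Z n p E b ** logic k)"
        using k b \<open>odd n\<close> flipX by (intro transversal_image_ferm_Z_left) auto
      then show ?thesis using 2 by simp
    next
      case 3
      then have "transversal_image ?U k (logic k)"
        using heisenberg_commute[OF un] far k by (intro transversal_image_eq) auto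
      then show ?thesis using 3 by auto
    qed
  qed auto
qed

end

theorem mainTheorem6:
  fixes d n :: nat
    and vert :: "nat \<Rightarrow> int \<times> int"
    and F :: "'f set" and Q :: "'q set"
    and p :: "'f \<Rightarrow> nat \<Rightarrow> 'h::finite operator"
    and E :: "'q \<Rightarrow> nat \<Rightarrow> bool \<Rightarrow> bool \<Rightarrow> 'h operator"
  assumes "odd d" and "d \<ge> 3"
    and "n = (3 * d^2 + 1) div 4"
    and "bij_betw vert {1..n} (vertices d)"
    and "fermion_system n F p"
    and "qubit_system n Q E"
    and "qubits_commute_with_fermions n F Q p E"
  shows
    "(\<forall>a\<in>F. \<forall>b\<in>F. a \<noteq> b \<longrightarrow>
        logical_gate (site_plaquettes d n vert) n F Q p E
          (site_prod {1..n} (\<lambda>i. BRAID p a i b i))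
          ((logical n p E)
             (MajT a := - logical n p E (Maj b),
              Maj b := logical n p E (MajT a)))) \<and>
     (\<forall>a\<in>F.
        logical_gate (site_plaquettes d n vert) n F Q p E
          (site_prod {1..n} (\<lambda>i. S_f p a i))
          ((logical n p E)
             (Maj a := logical n p E (MajT a),
              MajT a := - logical n p E (Maj a)))) \<and>
     (\<forall>a\<in>F. \<forall>b\<in>F. a \<noteq> b \<longrightarrow>
        logical_gate (site_plaquettes d n vert) n F Q p E
          (site_prod {1..n} (\<lambda>i. CZ_f p a i b i))
          ((logical n p E)
             (Maj a := logical n p E (Maj a) ** logical_ferm_Z n p E b,
              MajT a := logical n p E (MajT a) ** logical_ferm_Z n p E b,
              Maj b := logical n p E (Maj b) ** logical_ferm_Z n p E a,
              MajT b := logical n p E (MajT b) ** logical_ferm_Z n p E a))) \<and>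
     (\<forall>q\<in>Q. \<forall>b\<in>F.
        logical_gate (site_plaquettes d n vert) n F Q p E
          (site_prod {1..n} (\<lambda>i. CZ_qf p E q i b i))
          ((logical n p E)
             (Maj b := logical n p E (PZ q) ** logical n p E (Maj b),
              MajT b := logical n p E (PZ q) ** logical n p E (MajT b),
              PX q := logical_ferm_Z n p E b ** logical n p E (PX q))))"
proof -
  interpret code_blocks n F Q p E
    using assms(5-7) by unfold_locales
  \<comment> \<open>The lattice enters the gate lemmas through two facts: the parity of
    \<open>n\<close> and the plaquette sizes.\<close>
  have n: "odd n"
    using assms(1,3) by (rule odd_number_of_sites)
  have Ps: "\<And>S. S \<in> site_plaquettes d n vert \<Longrightarrow> S \<subseteq> {1..n} \<and> card S \<in> {4, 6}"
    using assms(1,4) by (rule card_site_plaquette)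
  show ?thesis
    by (intro conjI ballI impI)
      (rule BRAID_gate[OF _ _ n Ps] S_f_gate[OF _ n Ps] CZ_f_gate[OF _ _ _ n Ps] CZ_qf_gate[OF _ _ n Ps];
        assumption)+
qed

end
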